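(* Let $\ell>0$ and let $\mathcal{V}\in\mathbb{R}^{3V}$ be a closed space polygon with $\mathrm{CThi}(\ell,\mathcal{V})\ge 1$. The set $I(\mathcal{V})$ of infinitesimal motions of $\mathcal{V}$ is the dual cone of the set of vectors in $\mathbb{R}^{3V}$ consisting of $-\nabla\frac{d(p,q)}{2}$ for $(p,q)\in\mathrm{Strut}(\mathcal{V})$ and $-\nabla\,\mathrm{MinRad}^{\pm}v_i$ for $(v_i,\pm)\in\mathrm{Kink}(\mathcal{V})$.
   Context: A closed space polygon $\mathcal{V}$ (possibly with several components) has vertices $v_1,\dots,v_V\in\mathbb{R}^3$ and edges $e_1,\dots,e_V$, where $e_{i-1},e_i$ are the edges meeting at $v_i$ (indices cyclic on each component); it is viewed as $(v_1,\dots,v_V)\in\mathbb{R}^{3V}$. $\theta_i$ denotes the turning angle at $v_i$. $\mathrm{MinRad}(v_i)=\min\{\mathrm{MinRad}^-(v_i),\mathrm{MinRad}^+(v_i)\}$ with $\mathrm{MinRad}^-(v_i)=\frac{|e_{i-1}|}{2\tan(\theta_i/2)}$ and $\mathrm{MinRad}^+(v_i)=\frac{|e_i|}{2\tan(\theta_i/2)}$; vertices with $\theta_i=0$, where these are undefined (infinite), are ignored in minima. For points $p,q$ on $\mathcal{V}$, $d(p,q)=\|p-q\|$. Let $\theta(1,\ell)=2\arctan(\ell/2)$. Let $\mathrm{vb}(p,q)$ be $\infty$ if $p,q$ lie on different components of $\mathcal{V}$, and otherwise the smaller (over the two arcs joining $p$ and $q$) of the number of vertices between $p$ and $q$, counting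 $p$ and/or $q$ if they are vertices. Set $\mathrm{VB}(1,\ell)=\{(p,q)\in\mathcal{V}\times\mathcal{V}: \mathrm{vb}(p,q)\ge \pi/\theta(1,\ell)\}$. The constraint thickness is $$\mathrm{CThi}(\ell,\mathcal{V})=\min\Big\{\min_i \mathrm{MinRad}(v_i),\ \min_{(p,q)\in \mathrm{VB}(1,\ell)}\tfrac{d(p,q)}{2}\Big\}.$$ $\mathrm{Strut}(\mathcal{V})$ is the set of pairs $(p,q)\in\mathrm{VB}(1,\ell)$ with $d(p,q)/2=1$ such that either $(p,q)$ is an isolated local minimum of $d$ (as a function on $\mathrm{VB}(1,\ell)$), or $(p,q)$ is an endpoint of a family (a nondegenerate interval of corresponding pairs, lying on two parallel edges) of local minima of $d$. $\mathrm{Kink}(\mathcal{V})$ is the set of pairs $(v_i,\pm)$ with $\mathrm{MinRad}^{\pm}(v_i)=1$. Both sets are empty if $\mathrm{CThi}(\ell,\mathcal{V})>1$. A variation $W=(w_1,\dots,w_V)\in\mathbb{R}^{3V}$ moves $\mathcal{V}$ to $\mathcal{V}+tW$, carrying $p=\alpha v_i+(1-\alpha)v_{i+1}$ to the point with the same $\alpha$ on the moved edge; gradients of $d(p,q)/2$ and $\mathrm{MinRad}^\pm v_i$ are taken in $\mathbb{R}^{3V}$ with respect to the vertex positions with these $\alpha$'s fixed. $D_W\mathrm{CThi}(\ell,\mathcal{V})=\frac{d}{dt^+}\mathrm{CThi}(\ell,\mathcal{V}+tW)|_{t=0}$ is the forward directional derivative. If $\mathrm{CThi}(\ell,\mathcal{V})=1$,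 $W$ is an infinitesimal motion of $\mathcal{V}$ if $D_W\mathrm{CThi}(\ell,\mathcal{V})\ge 0$; if $\mathrm{CThi}(\ell,\mathcal{V})>1$ every variation is an infinitesimal motion. $I(\mathcal{V})$ is the set of all infinitesimal motions. The dual cone of a set $A\subset\mathbb{R}^{3V}$ is $A^+=\{X: \langle X,W\rangle\le 0\text{ for all }W\in A\}$. *)

theory Defs
  imports "HOL-Analysis.Analysis"
begin

(* A polygon with V vertices is a vector of type real^3^'n, CARD('n) = V. The component structure
   is a permutation \<sigma> of the indices: \<sigma> i is the cyclic successor of i on its component, the cycles
   of \<sigma> are the components, and edge i runs from vertex i to vertex \<sigma> i. *)

definition edge :: "('n \<Rightarrow> 'n) \<Rightarrow> real^3^'n \<Rightarrow> 'n \<Rightarrow> real^3" where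
  "edge \<sigma> V i = V $ \<sigma> i - V $ i"

definition closed_polygon :: "('n::finite \<Rightarrow> 'n) \<Rightarrow> real^3^'n \<Rightarrow> bool" where
  "closed_polygon \<sigma> V \<longleftrightarrow>
     bij \<sigma> \<and> (\<forall>i. \<sigma> i \<noteq> i \<and> \<sigma> (\<sigma> i) \<noteq> i) \<and> (\<forall>i. edge \<sigma> V i \<noteq> 0)"

datatype side = Minus | Plus

fun adjacent_edge :: "('n \<Rightarrow> 'n) \<Rightarrow> real^3^'n \<Rightarrow> 'n \<Rightarrow> side \<Rightarrow> real^3" where
  "adjacent_edge \<sigma> V i Minus = edge \<sigma> V (inv \<sigma> i)"
| "adjacent_edge \<sigma> V i Plus = edge \<sigma> V i"

definition turning_angle :: "('n \<Rightarrow> 'n) \<Rightarrow> real^3^'n \<Rightarrow> 'n \<Rightarrow> real" where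
  "turning_angle \<sigma> V i =
     (let a = adjacent_edge \<sigma> V i Minus; b = adjacent_edge \<sigma> V i Plus
      in arccos (a \<bullet> b / (norm a * norm b)))"

(* For turning angle 0 the paper's value is infinite, while division by zero yields 0 here; such
   vertices are filtered out wherever minrad_side is used. For turning angle pi we have
   tan (pi / 2) = 0 in HOL, and the value 0 agrees with the limit. *)
definition minrad_side :: "('n \<Rightarrow> 'n) \<Rightarrow> side \<Rightarrow> 'n \<Rightarrow> real^3^'n \<Rightarrow> real" where
  "minrad_side \<sigma> s i V = norm (adjacent_edge \<sigma> V i s) / (2 * tan (turning_angle \<sigma> V i / 2))"

definition minrad :: "('n \<Rightarrow> 'n) \<Rightarrow> 'n \<Rightarrow> real^3^'n \<Rightarrow> real" where
  "minrad \<sigma> i V = min (minrad_side \<sigma> Minus i V) (minrad_side \<sigma> Plus i V)"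

(* Points of the polygon are represented by barycentric coordinates: the point
   \<alpha> v_i + (1 - \<alpha>) v_(\<sigma> i) is the vector \<alpha> axis i 1 + (1 - \<alpha>) axis (\<sigma> i) 1 of real^'n.
   Thus polygon_points \<sigma> is a disjoint union of circles, independent of V; it carries the
   topology of the polygon as a (not necessarily embedded) closed curve, and holding the
   coordinates fixed while V varies is exactly how a variation carries points along. *)

definition vertex :: "'n::finite \<Rightarrow> real^'n" where
  "vertex i = axis i 1"

definition edge_points :: "('n::finite \<Rightarrow> 'n) \<Rightarrow> 'n \<Rightarrow> (real^'n) set" where
  "edge_points \<sigma> i = closed_segment (vertex i) (vertex (\<sigma> i))"

definition polygon_points :: "('n::finite \<Rightarrow> 'n) \<Rightarrow> (real^'n) set" where
  "polygon_points \<sigma> = (\<Union>i. edge_points \<sigma> i)"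

definition position :: "real^3^'n \<Rightarrow> real^'n \<Rightarrow> real^3" where
  "position V p = (\<Sum>i\<in>UNIV. (p $ i) *\<^sub>R (V $ i))"

definition pdist :: "real^'n \<Rightarrow> real^'n \<Rightarrow> real^3^'n \<Rightarrow> real" where
  "pdist p q V = dist (position V p) (position V q)"

(* For p = q the two arcs are the point itself and the whole component; the latter never has
   fewer vertices and is left out. *)
definition joining_arcs :: "('n::finite \<Rightarrow> 'n) \<Rightarrow> real^'n \<Rightarrow> real^'n \<Rightarrow> (real^'n) set set" where
  "joining_arcs \<sigma> p q =
     (if p = q then {{p}}
      else {path_image g | g. arc g \<and> pathstart g = p \<and> pathfinish g = q \<and>
                              path_image g \<subseteq> polygon_points \<sigma>})"

(* On different components there are no joining arcs, and the infimum of the empty set is \<infinity>. *)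
definition vb :: "('n::finite \<Rightarrow> 'n) \<Rightarrow> real^'n \<Rightarrow> real^'n \<Rightarrow> enat" where
  "vb \<sigma> p q = (INF A\<in>joining_arcs \<sigma> p q. enat (card {i. vertex i \<in> A}))"

definition theta1 :: "real \<Rightarrow> real" where
  "theta1 l = 2 * arctan (l / 2)"

definition VB1 :: "('n::finite \<Rightarrow> 'n) \<Rightarrow> real \<Rightarrow> ((real^'n) \<times> (real^'n)) set" where
  "VB1 \<sigma> l = {(p, q) \<in> polygon_points \<sigma> \<times> polygon_points \<sigma>.
                ereal (pi / theta1 l) \<le> ereal_of_enat (vb \<sigma> p q)}"

(* One infimum over the union replaces the minimum of two minima because VB1 may be empty. The
   union is nonempty, as a closed polygon has a vertex with nonzero turning angle, and the infimum
   is attained, as VB1 is compact. *)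
definition cthi :: "('n::finite \<Rightarrow> 'n) \<Rightarrow> real \<Rightarrow> real^3^'n \<Rightarrow> real" where
  "cthi \<sigma> l V = Inf ({minrad \<sigma> i V | i. turning_angle \<sigma> V i \<noteq> 0} \<union>
                      {pdist p q V / 2 | p q. (p, q) \<in> VB1 \<sigma> l})"

definition local_minima ::
    "('n::finite \<Rightarrow> 'n) \<Rightarrow> real \<Rightarrow> real^3^'n \<Rightarrow> ((real^'n) \<times> (real^'n)) set" where
  "local_minima \<sigma> l V = {(p, q) \<in> VB1 \<sigma> l.
     \<forall>\<^sub>F (p', q') in at (p, q) within VB1 \<sigma> l. pdist p q V \<le> pdist p' q' V}"

(* The segment from a to b in edge i x edge j (a product of two segments in barycentric
   coordinates) is a maximal nondegenerate family of local minima on the parallel edges i, j. *)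
definition minimum_family ::
    "('n::finite \<Rightarrow> 'n) \<Rightarrow> real \<Rightarrow> real^3^'n \<Rightarrow> 'n \<Rightarrow> 'n \<Rightarrow>
     (real^'n) \<times> (real^'n) \<Rightarrow> (real^'n) \<times> (real^'n) \<Rightarrow> bool" where
  "minimum_family \<sigma> l V i j a b \<longleftrightarrow>
     (let M = local_minima \<sigma> l V \<inter> edge_points \<sigma> i \<times> edge_points \<sigma> j in
      a \<noteq> b \<and> collinear {0, edge \<sigma> V i, edge \<sigma> V j} \<and> closed_segment a b \<subseteq> M \<and>
      (\<forall>a' b'. closed_segment a b \<subseteq> closed_segment a' b' \<and> closed_segment a' b' \<subseteq> M
               \<longrightarrow> closed_segment a' b' = closed_segment a b))"

(* If cthi \<sigma> l V > 1, then Strut and Kink are empty without this being stipulated, because every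
   half-distance over VB1 and every MinRad is at least cthi \<sigma> l V. *)

definition Strut ::
    "('n::finite \<Rightarrow> 'n) \<Rightarrow> real \<Rightarrow> real^3^'n \<Rightarrow> ((real^'n) \<times> (real^'n)) set" where
  "Strut \<sigma> l V = {(p, q) \<in> VB1 \<sigma> l. pdist p q V / 2 = 1 \<and>
     ((p, q) isolated_in local_minima \<sigma> l V \<or>
      (\<exists>i j a b. minimum_family \<sigma> l V i j a b \<and> (p, q) \<in> {a, b}))}"

definition Kink :: "('n \<Rightarrow> 'n) \<Rightarrow> real^3^'n \<Rightarrow> ('n \<times> side) set" where
  "Kink \<sigma> V = {(i, s). turning_angle \<sigma> V i \<noteq> 0 \<and> minrad_side \<sigma> s i V = 1}"

definition gradient :: "('a::real_inner \<Rightarrow> real) \<Rightarrow> 'a \<Rightarrow> 'a" where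
  "gradient f x = (THE D. GDERIV f x :> D)"

definition infinitesimal_motions ::
    "('n::finite \<Rightarrow> 'n) \<Rightarrow> real \<Rightarrow> real^3^'n \<Rightarrow> (real^3^'n) set" where
  "infinitesimal_motions \<sigma> l V = {W. cthi \<sigma> l V > 1 \<or> cthi \<sigma> l V = 1 \<and>
     (\<exists>D\<ge>0. ((\<lambda>t. cthi \<sigma> l (V + t *\<^sub>R W)) has_real_derivative D) (at_right 0))}"

(* The sign convention is that of the polar cone. *)
definition dual_cone :: "'a::real_inner set \<Rightarrow> 'a set" where
  "dual_cone A = {X. \<forall>W\<in>A. X \<bullet> W \<le> 0}"

end

theory Submission
  imports Defs
begin

text \<open>
  The thickness is the infimum of a family of functions of the polygon: the half-distances of the
  pairs in VB1, and the values of MinRad. Near a polygon of thickness 1 each of them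
  is differentiable or too large to matter, and their values and slopes form a compact set. So the
  forward derivative in a direction \<open>W\<close> exists and is the smallest slope among the constraints
  that are active, that is, have value 1 (Danskin's theorem, \<open>right_derivative_of_infimum\<close>).
  Hence \<open>W\<close> is an infinitesimal motion exactly if no active constraint has a negative slope.

  The active MinRad constraints are the kinks. Among the active pairs only some are struts, so the
  point is that the slopes at the struts control the slopes at all active pairs
  (\<open>shortest_pair_between_struts\<close>). VB1 is a finite union of products of closed faces, where a face
  is an edge or a vertex: moving a point from the interior of an edge to anywhere on that edge never
  lowers the vertex count (\<open>vb_mono_endpoint\<close>). On such a convex cell the vector from one point
  to the other is affine in the pair, and its norm is strictly convex, so all minimizing pairs of the
  cell have the same separation vector. If an active pair is not isolated among the local
  minima, then by finiteness one cell contains another minimizing pair. Two pairs with equal separation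
  vectors can only arise by sliding both points along parallel edges, so the minimizing pairs of the
  cell form a segment, whose end points are struts. As the separation vector is constant along this segment,
  the slope is affine there, and it is nonnegative on the segment once it is so at both ends.

  If the thickness exceeds 1, no constraint is active and both sides are the whole space.
\<close>

section \<open>The right derivative of an infimum\<close>

text \<open>
  Danskin's theorem. Compactness is required of the set of pairs (value, slope) in the plane rather
  than of the index set, so that finitely many curvature constraints and a continuum of distance
  constraints can be treated as one family without a topology on their disjoint union. An index
  that is not minimal contributes only through its slope: if its slope is markedly below the minimal
  active slope, compactness keeps its value away from the minimum.
\<close>

lemma right_derivative_of_infimum:
  fixes f :: "real \<Rightarrow> 'k \<Rightarrow> real" and f' :: "'k \<Rightarrow> real"
  assumes compact: "compact ((\<lambda>k. (f 0 k, f' k)) ` K)" and "K \<noteq> {}"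
    and expansion: "\<And>e. e > 0 \<Longrightarrow>
      \<forall>\<^sub>F t in at_right 0. \<forall>k\<in>K. \<bar>f t k - f 0 k - t * f' k\<bar> \<le> e * t"
  obtains k0 where "k0 \<in> K" "\<forall>k\<in>K. f 0 k0 \<le> f 0 k"
    "\<forall>k\<in>K. f 0 k = f 0 k0 \<longrightarrow> f' k0 \<le> f' k"
    "((\<lambda>t. Inf (f t ` K)) has_real_derivative f' k0) (at_right 0)"
proof -
  define T where "T = (\<lambda>k. (f 0 k, f' k)) ` K"
  have T: "compact T" "T \<noteq> {}" using compact \<open>K \<noteq> {}\<close> by (auto simp: T_def)
  obtain z where z: "z \<in> T" "\<And>y. y \<in> T \<Longrightarrow> fst z \<le> fst y"
    using continuous_attains_inf[OF T, of fst] continuous_on_fst continuous_on_id by blast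
  define m where "m = fst z"
  have "closed {y::real\<times>real. fst y = m}"
    by (intro closed_Collect_eq continuous_intros)
  then have cT: "compact (T \<inter> {y. fst y = m})" using T by (simp add: compact_Int_closed)
  have "T \<inter> {y. fst y = m} \<noteq> {}" using z m_def by auto
  from continuous_attains_inf[OF cT this, of snd] obtain z0
    where z0: "z0 \<in> T" "fst z0 = m" "\<And>y. y \<in> T \<Longrightarrow> fst y = m \<Longrightarrow> snd z0 \<le> snd y"
    using continuous_on_snd continuous_on_id by blast
  then obtain k0 where k0: "k0 \<in> K" "f 0 k0 = m" "f' k0 = snd z0" unfolding T_def by auto
  define D where "D = f' k0"
  have min0: "f 0 k0 \<le> f 0 k" if "k \<in> K" for k
    using z(2)[of "(f 0 k, f' k)"] that k0 m_def by (auto simp: T_def)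
  have min1: "D \<le> f' k" if "k \<in> K" "f 0 k = m" for k
    using z0(3)[of "(f 0 k, f' k)"] that k0 D_def by (auto simp: T_def)
  obtain B where B: "\<And>k. k \<in> K \<Longrightarrow> - B \<le> f' k"
  proof -
    obtain y where "y \<in> T" "\<And>x. x \<in> T \<Longrightarrow> snd y \<le> snd x"
      using continuous_attains_inf[OF T, of snd] continuous_on_snd continuous_on_id by blast
    then show ?thesis using that[of "- snd y"] by (force simp: T_def)
  qed
  have estimate: "\<forall>\<^sub>F t in at_right 0. \<bar>Inf (f t ` K) - m - t * D\<bar> \<le> e * t" if "e > 0" for e
  proof -
    \<comment> \<open>Indices whose slope is well below \<open>D\<close> are separated from the minimum value by a gap.\<close>
    obtain d where d: "d > 0" "\<And>k. k \<in> K \<Longrightarrow> f' k \<le> D - e/2 \<Longrightarrow> m + d \<le> f 0 k"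
    proof (cases "T \<inter> {y. snd y \<le> D - e/2} = {}")
      case True
      then show ?thesis using that[of 1] by (force simp: T_def)
    next
      case False
      have "closed {y::real\<times>real. snd y \<le> D - e/2}"
        by (intro closed_Collect_le continuous_intros)
      then have "compact (T \<inter> {y. snd y \<le> D - e/2})" using T by (simp add: compact_Int_closed)
      from continuous_attains_inf[OF this False, of fst] obtain y where
        y: "y \<in> T" "snd y \<le> D - e/2" "\<And>x. x \<in> T \<Longrightarrow> snd x \<le> D - e/2 \<Longrightarrow> fst y \<le> fst x"
        using continuous_on_fst continuous_on_id by blast
      have "fst y > m"
        using y z(2)[OF y(1)] z0(3)[OF y(1)] k0 D_def m_def \<open>e > 0\<close> by fastforce
      then show ?thesis
        using that[of "fst y - m"] y(3) by (force simp: T_def)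
    qed
    have "((\<lambda>t. t * (B + \<bar>D\<bar>)) \<longlongrightarrow> 0 * (B + \<bar>D\<bar>)) (at_right 0)" by (intro tendsto_intros)
    then have small: "\<forall>\<^sub>F t in at_right 0. t * (B + \<bar>D\<bar>) < d"
      using d by (simp add: order_tendstoD)
    show ?thesis
      using expansion[OF half_gt_zero[OF \<open>e > 0\<close>]] small eventually_at_right_less[of 0]
    proof eventually_elim
      case (elim t)
      have lower: "m + t * D - e * t \<le> f t k" if k: "k \<in> K" for k
      proof (cases "f' k \<le> D - e/2")
        case True
        have "t * - B \<le> t * f' k" using B[OF k] elim by (intro mult_left_mono) auto
        moreover have "t * D \<le> t * \<bar>D\<bar>" using elim by (intro mult_left_mono) auto
        moreover have "e * t > 0" using elim \<open>e > 0\<close> by simp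
        moreover have "\<bar>f t k - f 0 k - t * f' k\<bar> \<le> e/2 * t" using elim k by blast
        moreover have "t * (B + \<bar>D\<bar>) = t * B + t * \<bar>D\<bar>" by (rule distrib_left)
        moreover have "t * - B = - (t * B)" by simp
        moreover have "e/2 * t = e * t / 2" by simp
        ultimately show ?thesis using d(2)[OF k True] elim(2) by linarith
      next
        case False
        then have "t * (D - e/2) \<le> t * f' k" using elim by (intro mult_left_mono) auto
        moreover have "\<bar>f t k - f 0 k - t * f' k\<bar> \<le> e/2 * t" using elim k by blast
        moreover have "m \<le> f 0 k" using min0[OF k] k0 by simp
        moreover have "t * (D - e/2) = t * D - e * t / 2" "e/2 * t = e * t / 2"
          by (simp_all add: algebra_simps)
        ultimately show ?thesis by linarith
      qed
      have "m + t * D - e * t \<le> Inf (f t ` K)"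
        using lower \<open>K \<noteq> {}\<close> by (intro cInf_greatest) auto
      moreover have "Inf (f t ` K) \<le> f t k0"
        using lower k0 by (intro cInf_lower bdd_belowI) auto
      moreover have "\<bar>f t k0 - m - t * D\<bar> \<le> e/2 * t" using elim k0 D_def by auto
      moreover have "e * t > 0" using elim \<open>e > 0\<close> by simp
      ultimately show ?case by linarith
    qed
  qed
  have at0: "Inf (f 0 ` K) = m"
    using min0 k0 by (intro cInf_eq_minimum) auto
  have "((\<lambda>t. (Inf (f t ` K) - Inf (f 0 ` K)) / (t - 0)) \<longlongrightarrow> D) (at_right 0)"
  proof (rule tendstoI)
    fix e :: real assume "e > 0"
    show "\<forall>\<^sub>F t in at_right 0. dist ((Inf (f t ` K) - Inf (f 0 ` K)) / (t - 0)) D < e"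
      using estimate[OF half_gt_zero[OF \<open>e > 0\<close>]] eventually_at_right_less[of 0]
    proof eventually_elim
      case (elim t)
      have "(Inf (f t ` K) - m) / t - D = (Inf (f t ` K) - m - t * D) / t"
        using elim by (simp add: field_simps)
      then have "\<bar>(Inf (f t ` K) - m) / t - D\<bar> \<le> e/2"
        using elim by (simp add: field_simps)
      then show ?case using \<open>e > 0\<close> by (simp add: at0 dist_real_def)
    qed
  qed
  then have "((\<lambda>t. Inf (f t ` K)) has_real_derivative D) (at_right 0)"
    by (simp add: has_field_derivative_iff)
  then show ?thesis using k0 min0 min1 unfolding D_def by (intro that[of k0]) auto
qed

section \<open>The cell structure of the constrained pairs\<close>

lemma norm_vertex [simp]: "norm (vertex i :: real^'n::finite) = 1"
  by (simp add: vertex_def)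

text \<open>
  Barycentric coordinates put the vertices of the polygon on the unit sphere and all its points
  in the unit ball, so strict convexity of the ball makes vertices extreme points.
\<close>

lemma unit_vector_in_ball_segment:
  fixes x :: "'a::euclidean_space"
  assumes "x \<in> closed_segment a b" "norm a \<le> 1" "norm b \<le> 1" "norm x = 1"
  shows "x = a \<or> x = b"
proof (rule ccontr)
  assume "\<not> ?thesis"
  then have "x \<in> open_segment a b" using assms by (simp add: open_segment_def)
  from dist_decreases_open_segment[OF this, of 0] show False using assms by auto
qed

lemma norm_edge_points: "p \<in> edge_points \<sigma> i \<Longrightarrow> norm p \<le> 1"
  unfolding edge_points_def
  using segment_furthest_le[of p "vertex i" "vertex (\<sigma> i)" 0] by auto

lemma vertex_in_edge_points_segment:
  assumes "vertex k \<in> closed_segment p p'" "p \<in> edge_points \<sigma> i" "p' \<in> edge_points \<sigma> i"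
  shows "vertex k = p \<or> vertex k = p'"
  using assms norm_edge_points unit_vector_in_ball_segment norm_vertex by metis

lemma arc_tail:
  fixes g :: "real \<Rightarrow> 'a::real_normed_vector"
  assumes "arc g" "r \<in> path_image g" "r \<noteq> pathfinish g"
  obtains h where "arc h" "pathstart h = r" "pathfinish h = pathfinish g"
    "path_image h \<subseteq> path_image g"
proof -
  obtain u where u: "u \<in> {0..1}" "g u = r" using assms(2) by (auto simp: path_image_def)
  with assms(3) have "u \<noteq> 1" by (auto simp: pathfinish_def)
  show ?thesis
  proof
    show "arc (subpath u 1 g)" using arc_subpath_arc[of g u 1] assms u \<open>u \<noteq> 1\<close> by auto
    show "path_image (subpath u 1 g) \<subseteq> path_image g"
      using path_image_subpath_subset[of u 1 g] u by auto
  qed (use u in \<open>auto simp: pathstart_def pathfinish_def subpath_def\<close>)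
qed

text \<open>
  Every arc from \<open>p'\<close> to \<open>q\<close> can be turned into one from \<open>p\<close> to \<open>q\<close> that meets no further
  vertex: if the arc passes through \<open>p\<close>, cut it there; otherwise run from \<open>p\<close> towards \<open>p'\<close> until
  the arc is first met, and follow it from there. The added piece is contained in an edge and starts
  in its interior, so the only vertex that it can meet is \<open>p'\<close>, which the given arc contains.
\<close>

lemma vb_mono_endpoint:
  fixes \<sigma> :: "'n::finite \<Rightarrow> 'n"
  assumes p: "p \<in> edge_points \<sigma> i" "p \<notin> range vertex" and p': "p' \<in> edge_points \<sigma> i"
  shows "vb \<sigma> p q \<le> vb \<sigma> p' q"
proof (cases "p = q")
  case True
  then have "{i. vertex i \<in> {p}} = {}" using p by auto
  then have "vb \<sigma> p q = 0" using True unfolding vb_def joining_arcs_def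
    by (simp add: zero_enat_def)
  then show ?thesis by simp
next
  case False
  have "\<exists>A\<in>joining_arcs \<sigma> p q. enat (card {k. vertex k \<in> A}) \<le> enat (card {k. vertex k \<in> A'})"
    if A': "A' \<in> joining_arcs \<sigma> p' q" for A'
  proof -
    have edge: "edge_points \<sigma> i \<subseteq> polygon_points \<sigma>" by (auto simp: polygon_points_def)
    have "closed A' \<and> p' \<in> A' \<and> A' \<subseteq> polygon_points \<sigma>"
      using A' p' edge unfolding joining_arcs_def
      by (auto split: if_splits simp: closed_path_image arc_imp_path)
    then have A'_props: "closed A'" "p' \<in> A'" "A' \<subseteq> polygon_points \<sigma>" by auto
    have tail: "\<exists>h. arc h \<and> pathstart h = r \<and> pathfinish h = q \<and> path_image h \<subseteq> A'"
      if r: "r \<in> A'" "r \<noteq> q" for r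
    proof -
      obtain g where "arc g" "pathfinish g = q" "path_image g = A'"
        using A' r unfolding joining_arcs_def by (cases "p' = q") auto
      then show ?thesis using arc_tail[of g r] r by metis
    qed
    have suffices: ?thesis if "arc h" "pathstart h = p" "pathfinish h = q"
      "path_image h \<subseteq> polygon_points \<sigma>" "\<And>k. vertex k \<in> path_image h \<Longrightarrow> vertex k \<in> A'" for h
    proof (rule bexI)
      show "path_image h \<in> joining_arcs \<sigma> p q" using that False by (auto simp: joining_arcs_def)
      show "enat (card {k. vertex k \<in> path_image h}) \<le> enat (card {k. vertex k \<in> A'})"
        using that(5) by (auto intro!: card_mono)
    qed
    show ?thesis
    proof (cases "p \<in> A'")
      case True
      then obtain h where "arc h" "pathstart h = p" "pathfinish h = q" "path_image h \<subseteq> A'"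
        using tail False by blast
      then show ?thesis using suffices A'_props by blast
    next
      case out: False
      have "closed (A' \<inter> closed_segment p p')" "A' \<inter> closed_segment p p' \<noteq> {}"
        using A'_props by auto
      then obtain r where r_min: "r \<in> A' \<inter> closed_segment p p'"
        "\<And>s. s \<in> A' \<inter> closed_segment p p' \<Longrightarrow> dist p r \<le> dist p s"
        using distance_attains_inf[of "A' \<inter> closed_segment p p'" p] by metis
      then have r: "r \<in> A'" "r \<in> closed_segment p p'" by auto
      have closest: "dist p r \<le> dist p s" if "s \<in> A'" "s \<in> closed_segment p p'" for s
        using r_min(2) that by simp
      have "p \<noteq> r" using r out by auto
      have sub: "closed_segment p r \<subseteq> closed_segment p p'"
        using r by (simp add: subset_closed_segment)
      have only_r: "s = r" if "s \<in> A'" "s \<in> closed_segment p r" for s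
      proof (rule ccontr)
        assume "s \<noteq> r"
        then have "s \<in> open_segment p r" using that out by (auto simp: open_segment_def)
        then have "dist p s < dist p r"
          using dist_in_open_segment[of s p r] by (simp add: dist_commute)
        then show False using closest[of s] that sub by auto
      qed
      have "closed_segment p p' \<subseteq> edge_points \<sigma> i"
        using p p' unfolding edge_points_def by (simp add: subset_closed_segment)
      then have in_polygon: "closed_segment p r \<subseteq> polygon_points \<sigma>" using sub edge by blast
      have vertices: "vertex k \<in> A'" if "vertex k \<in> closed_segment p r" for k
      proof -
        have "vertex k = p'"
          using vertex_in_edge_points_segment[of k p p'] that sub p p' by blast
        then show ?thesis using A'_props by simp
      qed
      show ?thesis
      proof (cases "r = q")
        case True
        then show ?thesis
          using suffices[of "linepath p r"] \<open>p \<noteq> r\<close> in_polygon vertices by auto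
      next
        case r_q: False
        obtain h where h: "arc h" "pathstart h = r" "pathfinish h = q" "path_image h \<subseteq> A'"
          using tail r r_q by blast
        have "arc (linepath p r +++ h)"
          using h \<open>p \<noteq> r\<close> only_r by (intro arc_join) auto
        moreover have image: "path_image (linepath p r +++ h) = closed_segment p r \<union> path_image h"
          using h(2) by (simp add: path_image_join)
        moreover have "closed_segment p r \<union> path_image h \<subseteq> polygon_points \<sigma>"
          using in_polygon h(4) A'_props(3) by blast
        moreover have "vertex k \<in> A'" if "vertex k \<in> closed_segment p r \<union> path_image h" for k
          using that vertices h(4) by blast
        ultimately show ?thesis
          using suffices[of "linepath p r +++ h"] h(3) by simp
      qed
    qed
  qed
  then show ?thesis unfolding vb_def by (intro INF_mono) auto
qed

lemma vb_commute: "vb \<sigma> p q = vb \<sigma> q p"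
proof -
  have "joining_arcs \<sigma> p q \<subseteq> joining_arcs \<sigma> q p" for p q
  proof (cases "p = q")
    case False
    show ?thesis
    proof
      fix A assume "A \<in> joining_arcs \<sigma> p q"
      then obtain g where g: "arc g" "pathstart g = p" "pathfinish g = q"
        "path_image g \<subseteq> polygon_points \<sigma>" "A = path_image g"
        using False by (auto simp: joining_arcs_def)
      then have "arc (reversepath g) \<and> pathstart (reversepath g) = q \<and>
        pathfinish (reversepath g) = p \<and> path_image (reversepath g) = A"
        by (simp add: arc_reversepath)
      then have "\<exists>h. A = path_image h \<and> arc h \<and> pathstart h = q \<and> pathfinish h = p \<and>
        path_image h \<subseteq> polygon_points \<sigma>"
        using g(4,5) by (intro exI[of _ "reversepath g"]) simp
      then show "A \<in> joining_arcs \<sigma> q p"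
        using False by (simp add: joining_arcs_def)
    qed
  qed simp
  then show ?thesis unfolding vb_def by (metis subset_antisym)
qed

text \<open>
  The closed cells of the polygon. Every point lies in the relative interior of exactly one of them,
  which is what makes membership in VB1 spread from a pair to a whole product of faces.
\<close>

definition faces :: "('n::finite \<Rightarrow> 'n) \<Rightarrow> (real^'n) set set" where
  "faces \<sigma> = range (edge_points \<sigma>) \<union> range (\<lambda>i. {vertex i})"

lemma face_properties:
  assumes "A \<in> faces \<sigma>"
  shows "compact A" "convex A" "A \<subseteq> polygon_points \<sigma>"
  using assms by (auto simp: faces_def edge_points_def polygon_points_def)

lemma finite_faces: "finite (faces \<sigma>)"
  by (simp add: faces_def)

text \<open>
  The face is the one with \<open>p\<close> in its relative interior.
\<close>

lemma carrier_face:
  assumes "p \<in> polygon_points \<sigma>"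
  obtains A where "A \<in> faces \<sigma>" "p \<in> A" "\<And>p' q. p' \<in> A \<Longrightarrow> vb \<sigma> p q \<le> vb \<sigma> p' q"
proof (cases "p \<in> range vertex")
  case True
  then show ?thesis using that[of "{p}"] by (auto simp: faces_def)
next
  case False
  obtain i where "p \<in> edge_points \<sigma> i" using assms by (auto simp: polygon_points_def)
  then show ?thesis
    using vb_mono_endpoint False by (intro that[of "edge_points \<sigma> i"]) (auto simp: faces_def)
qed

text \<open>
  The two points of a pair can be moved within their faces one after the other.
\<close>

lemma VB1_cell:
  assumes "x \<in> VB1 \<sigma> l"
  obtains A B where "A \<in> faces \<sigma>" "B \<in> faces \<sigma>" "x \<in> A \<times> B" "A \<times> B \<subseteq> VB1 \<sigma> l"
proof -
  obtain p q where x: "x = (p, q)" by fastforce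
  have pq: "p \<in> polygon_points \<sigma>" "q \<in> polygon_points \<sigma>"
    "ereal (pi / theta1 l) \<le> ereal_of_enat (vb \<sigma> p q)"
    using assms by (auto simp: x VB1_def)
  obtain A where A: "A \<in> faces \<sigma>" "p \<in> A" "\<And>p' q. p' \<in> A \<Longrightarrow> vb \<sigma> p q \<le> vb \<sigma> p' q"
    using carrier_face pq(1) by blast
  obtain B where B: "B \<in> faces \<sigma>" "q \<in> B" "\<And>q' p. q' \<in> B \<Longrightarrow> vb \<sigma> q p \<le> vb \<sigma> q' p"
    using carrier_face pq(2) by blast
  have "(p', q') \<in> VB1 \<sigma> l" if "p' \<in> A" "q' \<in> B" for p' q'
  proof -
    have "vb \<sigma> p q \<le> vb \<sigma> p' q'"
      using A(3)[OF that(1), of q] B(3)[OF that(2), of p'] by (simp add: vb_commute)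
    then have "ereal_of_enat (vb \<sigma> p q) \<le> ereal_of_enat (vb \<sigma> p' q')" by simp
    then have "ereal (pi / theta1 l) \<le> ereal_of_enat (vb \<sigma> p' q')" using pq(3) order_trans by blast
    then show ?thesis
      using that A(1) B(1) face_properties(3) unfolding VB1_def by blast
  qed
  then show ?thesis using A B x by (intro that[of A B]) auto
qed

definition VB1_cells :: "('n::finite \<Rightarrow> 'n) \<Rightarrow> real \<Rightarrow> ((real^'n) \<times> (real^'n)) set set" where
  "VB1_cells \<sigma> l = {A \<times> B | A B. A \<in> faces \<sigma> \<and> B \<in> faces \<sigma> \<and> A \<times> B \<subseteq> VB1 \<sigma> l}"

lemma finite_VB1_cells: "finite (VB1_cells \<sigma> l)"
proof (rule finite_subset)
  show "VB1_cells \<sigma> l \<subseteq> (\<lambda>(A, B). A \<times> B) ` (faces \<sigma> \<times> faces \<sigma>)"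
    by (auto simp: VB1_cells_def)
qed (simp add: finite_faces)

lemma Union_VB1_cells: "\<Union>(VB1_cells \<sigma> l) = VB1 \<sigma> l"
proof (rule set_eqI)
  fix x
  show "x \<in> \<Union>(VB1_cells \<sigma> l) \<longleftrightarrow> x \<in> VB1 \<sigma> l"
  proof
    assume "x \<in> VB1 \<sigma> l"
    then obtain A B where "A \<in> faces \<sigma>" "B \<in> faces \<sigma>" "x \<in> A \<times> B" "A \<times> B \<subseteq> VB1 \<sigma> l"
      by (rule VB1_cell)
    then show "x \<in> \<Union>(VB1_cells \<sigma> l)" unfolding VB1_cells_def by blast
  qed (auto simp: VB1_cells_def)
qed

lemma compact_VB1: "compact (VB1 \<sigma> l)"
proof -
  have "\<forall>C\<in>VB1_cells \<sigma> l. compact C"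
    by (auto simp: VB1_cells_def intro: compact_Times face_properties)
  then have "compact (\<Union>(VB1_cells \<sigma> l))" using finite_VB1_cells[of \<sigma> l] by (intro compact_Union) auto
  then show ?thesis by (simp only: Union_VB1_cells)
qed

section \<open>Shortest pairs and struts\<close>

definition separation :: "real^3^'n \<Rightarrow> (real^'n::finite) \<times> (real^'n) \<Rightarrow> real^3" where
  "separation V x = position V (fst x) - position V (snd x)"

lemma pdist_separation: "pdist p q V = norm (separation V (p, q))"
  by (simp add: pdist_def separation_def dist_norm)

lemma linear_position: "linear (position V)"
  unfolding position_def by (auto intro!: linearI simp: scaleR_add_left sum.distrib scaleR_sum_right)

lemma linear_separation: "linear (separation V)"
  unfolding separation_def
  using linear_compose[OF linear_fst linear_position] linear_compose[OF linear_snd linear_position]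
  by (intro linear_compose_sub) (auto simp: o_def)

lemma linear_separation_polygon: "linear (\<lambda>U. separation U x)"
  unfolding separation_def position_def
  by (auto intro!: linearI simp: scaleR_add_right sum.distrib scaleR_sum_right scaleR_diff_right
      mult.commute)

lemma separation_variation: "separation (V + t *\<^sub>R W) x = separation V x + t *\<^sub>R separation W x"
  using linear_add[OF linear_separation_polygon[of x], of V "t *\<^sub>R W"]
    linear_scale[OF linear_separation_polygon[of x], of t W] by simp

lemma position_vertex [simp]: "position V (vertex i) = V $ i"
proof -
  have "position V (vertex i) = (\<Sum>k\<in>UNIV. if k = i then V $ k else 0)"
    unfolding position_def vertex_def by (intro sum.cong) (auto simp: axis_def)
  then show ?thesis by simp
qed

lemma edge_points_difference:
  assumes "p \<in> edge_points \<sigma> i" "p' \<in> edge_points \<sigma> i"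
  obtains s where "p' - p = s *\<^sub>R (vertex (\<sigma> i) - vertex i)"
    "position V p' - position V p = s *\<^sub>R edge \<sigma> V i"
proof -
  obtain u u' where u: "p = (1 - u) *\<^sub>R vertex i + u *\<^sub>R vertex (\<sigma> i)"
    "p' = (1 - u') *\<^sub>R vertex i + u' *\<^sub>R vertex (\<sigma> i)"
    using assms unfolding edge_points_def closed_segment_def by auto
  have d: "p' - p = (u' - u) *\<^sub>R (vertex (\<sigma> i) - vertex i)"
    unfolding u by (simp add: algebra_simps)
  have "position V p' - position V p = position V ((u' - u) *\<^sub>R (vertex (\<sigma> i) - vertex i))"
    using linear_diff[OF linear_position, of V p' p] d by simp
  also have "\<dots> = (u' - u) *\<^sub>R edge \<sigma> V i"
    by (simp add: linear_scale[OF linear_position] linear_diff[OF linear_position] edge_def)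
  finally show ?thesis using that d by blast
qed

text \<open>
  Otherwise strict convexity of the Euclidean norm would make the midpoint a better competitor.
\<close>

lemma norm_minimizers_same_image:
  fixes f :: "'a::real_vector \<Rightarrow> 'b::euclidean_space"
  assumes "linear f" "convex C" "x \<in> C" "y \<in> C"
    and "\<And>z. z \<in> C \<Longrightarrow> norm (f x) \<le> norm (f z)" "norm (f y) \<le> norm (f x)"
  shows "f y = f x"
proof (rule ccontr)
  assume "f y \<noteq> f x"
  then have "midpoint (f x) (f y) \<in> open_segment (f x) (f y)" by simp
  then have "norm (midpoint (f x) (f y)) < norm (f x)"
    using dist_decreases_open_segment[of _ "f x" "f y" 0] assms(6) by fastforce
  moreover have "midpoint (f x) (f y) = f (midpoint x y)"
    using \<open>linear f\<close> by (simp add: midpoint_def linear_add linear_scale)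
  moreover have "midpoint x y \<in> C"
    using convexD[OF assms(2-4), of "1/2" "1/2"] by (simp add: midpoint_def scaleR_add_right)
  ultimately show False using assms(5) by fastforce
qed

text \<open>
  The norm is convex along the segment from \<open>x\<close> to \<open>y\<close>, and a local minimum of a convex
  function is a global one. The neighbourhood is taken in the larger set \<open>S\<close>, because local minima of
  the distance are taken over all of VB1 and not over a single cell.
\<close>

lemma local_norm_minimum_is_global:
  fixes f :: "'a::real_normed_vector \<Rightarrow> 'b::real_normed_vector"
  assumes "linear f" "convex C" "C \<subseteq> S" "x \<in> C" "y \<in> C"
    and "\<forall>\<^sub>F z in at x within S. norm (f x) \<le> norm (f z)"
  shows "norm (f x) \<le> norm (f y)"
proof (cases "y = x")
  case False
  obtain d where d: "d > 0" "\<And>z. z \<in> S \<Longrightarrow> z \<noteq> x \<Longrightarrow> dist z x < d \<Longrightarrow> norm (f x) \<le> norm (f z)"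
    using assms(6) unfolding eventually_at by blast
  \<comment> \<open>A point of the segment so close to \<open>x\<close> that local minimality applies to it.\<close>
  define u where "u = min (1/2) (d / (2 * norm (y - x)))"
  define z where "z = (1 - u) *\<^sub>R x + u *\<^sub>R y"
  have u: "0 < u" "u < 1" using d False by (auto simp: u_def)
  have z_x: "z - x = u *\<^sub>R (y - x)" by (simp add: z_def algebra_simps)
  have "u * norm (y - x) \<le> d / (2 * norm (y - x)) * norm (y - x)"
    by (intro mult_right_mono) (auto simp: u_def)
  also have "\<dots> < d" using False d by simp
  finally have "dist z x < d" using z_x u by (simp add: dist_norm)
  moreover have "z \<noteq> x" using z_x u False by auto
  moreover have "z \<in> C"
    unfolding z_def using u assms(2,4,5) by (intro convexD) auto
  ultimately have "norm (f x) \<le> norm (f z)" using d assms(3) by auto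
  also have "f z = (1 - u) *\<^sub>R f x + u *\<^sub>R f y"
    unfolding z_def using \<open>linear f\<close> by (simp add: linear_add linear_scale)
  also have "norm \<dots> \<le> (1 - u) * norm (f x) + u * norm (f y)"
    using u norm_triangle_ineq[of "(1 - u) *\<^sub>R f x" "u *\<^sub>R f y"] by simp
  finally have "u * norm (f x) \<le> u * norm (f y)" by (simp add: algebra_simps)
  then show ?thesis using u by simp
qed simp

lemma local_minima_separation:
  "x \<in> local_minima \<sigma> l V \<longleftrightarrow> x \<in> VB1 \<sigma> l \<and>
    (\<forall>\<^sub>F y in at x within VB1 \<sigma> l. norm (separation V x) \<le> norm (separation V y))"
  by (cases x) (auto simp: local_minima_def pdist_separation case_prod_unfold)

lemma Strut_separation:
  "x \<in> Strut \<sigma> l V \<longleftrightarrow> x \<in> VB1 \<sigma> l \<and> norm (separation V x) = 2 \<and>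
    (x isolated_in local_minima \<sigma> l V \<or> (\<exists>i j a b. minimum_family \<sigma> l V i j a b \<and> x \<in> {a, b}))"
  by (cases x) (simp add: Strut_def pdist_separation)

text \<open>
  For an isolated pair, \<open>a = b = x\<close>. Otherwise infinitely many local minima accumulate at \<open>x\<close>
  inside one of the finitely many cells, and the minimizing pairs of that cell are those with the
  separation of \<open>x\<close>. A cell with a vertex as a factor contains just one such pair, since an edge is
  embedded by its end points; so the cell is a product of two edges, and these are parallel.
\<close>

lemma shortest_pair_between_struts:
  fixes \<sigma> :: "'n::finite \<Rightarrow> 'n"
  assumes polygon: "closed_polygon \<sigma> V" and x: "x \<in> VB1 \<sigma> l" "norm (separation V x) = 2"
    and shortest: "\<And>y. y \<in> VB1 \<sigma> l \<Longrightarrow> 2 \<le> norm (separation V y)"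
  obtains a b where "a \<in> Strut \<sigma> l V" "b \<in> Strut \<sigma> l V" "x \<in> closed_segment a b"
    "separation V a = separation V x" "separation V b = separation V x"
proof -
  let ?f = "separation V" and ?M = "local_minima \<sigma> l V"
  have minimum: "y \<in> ?M" if "y \<in> VB1 \<sigma> l" "norm (?f y) = 2" for y
    using that shortest unfolding local_minima_separation eventually_at
    by (auto intro!: exI[of _ 1])
  show ?thesis
  proof (cases "x isolated_in ?M")
    case True
    then have "x \<in> Strut \<sigma> l V"
      using x by (simp add: Strut_separation)
    then show ?thesis using that[of x x] by simp
  next
    case False
    let ?cells = "(\<lambda>C. ?M \<inter> C) ` VB1_cells \<sigma> l"
    have "x islimpt ?M" using False minimum x by (simp add: isolated_in_islimpt_iff)
    moreover have "?M = \<Union>?cells"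
      using Union_VB1_cells[of \<sigma> l] by (auto simp: local_minima_separation)
    ultimately obtain C where C: "C \<in> VB1_cells \<sigma> l" "x islimpt (?M \<inter> C)"
      using islimpt_finite_union_iff[of "VB1_cells \<sigma> l" x "\<lambda>C. ?M \<inter> C"] finite_VB1_cells
      by metis
    obtain A B where AB: "A \<in> faces \<sigma>" "B \<in> faces \<sigma>" "C = A \<times> B" "C \<subseteq> VB1 \<sigma> l"
      using C(1) by (auto simp: VB1_cells_def)
    have C_props: "compact C" "convex C"
      by (simp_all add: AB(3) compact_Times convex_Times face_properties[OF AB(1)]
          face_properties[OF AB(2)])
    have "x \<in> C"
      using C(2) compact_imp_closed[OF C_props(1)] by (metis closed_limpt inf_le2 islimpt_subset)
    have M_C: "y \<in> ?M \<longleftrightarrow> ?f y = ?f x" if "y \<in> C" for y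
    proof
      assume "y \<in> ?M"
      then have "norm (?f y) \<le> norm (?f x)"
        using local_norm_minimum_is_global[OF linear_separation C_props(2) AB(4) that \<open>x \<in> C\<close>]
        by (simp add: local_minima_separation)
      moreover have "norm (?f x) \<le> norm (?f z)" if "z \<in> C" for z
        using shortest[of z] that AB(4) x(2) by auto
      ultimately show "?f y = ?f x"
        using norm_minimizers_same_image[OF linear_separation C_props(2) \<open>x \<in> C\<close> that] by blast
    next
      assume "?f y = ?f x"
      then show "y \<in> ?M" using minimum[of y] AB(4) that x(2) by auto
    qed
    obtain y where y: "y \<in> ?M" "y \<in> C" "y \<noteq> x"
      using C(2) unfolding islimpt_def by (metis IntE UNIV_I open_UNIV)
    obtain i where i: "A \<subseteq> edge_points \<sigma> i" "A = edge_points \<sigma> i \<or> A = {vertex i}"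
      using AB(1) by (auto simp: faces_def edge_points_def)
    obtain j where j: "B \<subseteq> edge_points \<sigma> j" "B = edge_points \<sigma> j \<or> B = {vertex j}"
      using AB(2) by (auto simp: faces_def edge_points_def)
    have nonzero: "edge \<sigma> V i \<noteq> 0" "edge \<sigma> V j \<noteq> 0"
      using polygon by (auto simp: closed_polygon_def)
    define E where "E = vertex (\<sigma> i) - vertex i"
    define F where "F = vertex (\<sigma> j) - vertex j"
    \<comment> \<open>Inside the cell, keeping the separation fixed means sliding both points by equal vectors.\<close>
    have slide: "\<exists>s t. z - x = (s *\<^sub>R E, t *\<^sub>R F) \<and> s *\<^sub>R edge \<sigma> V i = t *\<^sub>R edge \<sigma> V j"
      if z: "z \<in> C" "?f z = ?f x" for z
    proof -
      obtain s where s: "fst z - fst x = s *\<^sub>R E"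
        "position V (fst z) - position V (fst x) = s *\<^sub>R edge \<sigma> V i"
        using edge_points_difference[of "fst x" \<sigma> i "fst z" V] z(1) \<open>x \<in> C\<close> i(1) AB(3) E_def
        by (auto simp: mem_Times_iff)
      obtain t where t: "snd z - snd x = t *\<^sub>R F"
        "position V (snd z) - position V (snd x) = t *\<^sub>R edge \<sigma> V j"
        using edge_points_difference[of "snd x" \<sigma> j "snd z" V] z(1) \<open>x \<in> C\<close> j(1) AB(3) F_def
        by (auto simp: mem_Times_iff)
      have "s *\<^sub>R edge \<sigma> V i = t *\<^sub>R edge \<sigma> V j"
        using z(2) s(2) t(2) by (simp add: separation_def algebra_simps)
      then show ?thesis using s(1) t(1) by (metis fst_diff snd_diff prod.collapse)
    qed
    obtain s t where st: "y - x = (s *\<^sub>R E, t *\<^sub>R F)" "s *\<^sub>R edge \<sigma> V i = t *\<^sub>R edge \<sigma> V j"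
      using slide y M_C by blast
    have "s \<noteq> 0" "t \<noteq> 0"
      using st nonzero y(3) by (auto simp: zero_prod_def[symmetric])
    have "E \<noteq> 0" "F \<noteq> 0"
      using nonzero by (auto simp: E_def F_def edge_def vertex_def axis_eq_axis)
    have "A = edge_points \<sigma> i"
      using i(2) y(2) \<open>x \<in> C\<close> st(1) \<open>s \<noteq> 0\<close> \<open>E \<noteq> 0\<close> AB(3)
      by (cases x; cases y) (auto simp: mem_Times_iff)
    have "B = edge_points \<sigma> j"
      using j(2) y(2) \<open>x \<in> C\<close> st(1) \<open>t \<noteq> 0\<close> \<open>F \<noteq> 0\<close> AB(3)
      by (cases x; cases y) (auto simp: mem_Times_iff)
    define k where "k = s / t"
    have parallel: "edge \<sigma> V j = k *\<^sub>R edge \<sigma> V i"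
      using arg_cong[OF st(2), of "\<lambda>v. (1 / t) *\<^sub>R v"] \<open>t \<noteq> 0\<close> by (simp add: k_def)
    define G where "G = ?M \<inter> C"
    have G_eq: "G = C \<inter> {z. ?f z = ?f x}" using M_C by (auto simp: G_def)
    have "x \<in> G" "y \<in> G" using y \<open>x \<in> C\<close> M_C by (auto simp: G_eq)
    have "closed {z. ?f z = ?f x}"
      using linear_continuous_on[of ?f UNIV] linear_separation linear_conv_bounded_linear
      by (intro closed_Collect_eq continuous_on_const) blast
    then have "compact G" using C_props by (simp add: G_eq compact_Int_closed)
    have "convex (?f -` {?f x})"
      by (intro convex_linear_vimage linear_separation) simp
    moreover have "?f -` {?f x} = {z. ?f z = ?f x}" by auto
    ultimately have "convex G" using C_props by (simp add: G_eq convex_Int)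
    have "\<exists>r. z - x = r *\<^sub>R (k *\<^sub>R E, F)" if "z \<in> G" for z
    proof -
      obtain s' t' where z: "z - x = (s' *\<^sub>R E, t' *\<^sub>R F)" "s' *\<^sub>R edge \<sigma> V i = t' *\<^sub>R edge \<sigma> V j"
        using slide[of z] \<open>z \<in> G\<close> unfolding G_eq by blast
      then have "s' = t' * k" using nonzero(1) parallel by simp
      then show ?thesis using z(1) by auto
    qed
    note on_line = this
    have "\<exists>r. z - w = r *\<^sub>R (k *\<^sub>R E, F)" if "z \<in> G" "w \<in> G" for z w
    proof -
      obtain r r' where r: "z - x = r *\<^sub>R (k *\<^sub>R E, F)" "w - x = r' *\<^sub>R (k *\<^sub>R E, F)"
        using on_line[of z] on_line[of w] \<open>z \<in> G\<close> \<open>w \<in> G\<close> by blast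
      have "z - w = (z - x) - (w - x)" by (simp only: diff_diff_eq2 diff_add_cancel)
      also have "\<dots> = (r - r') *\<^sub>R (k *\<^sub>R E, F)" unfolding r by (simp only: scaleR_diff_left)
      finally have "z - w = (r - r') *\<^sub>R (k *\<^sub>R E, F)" .
      then show ?thesis by blast
    qed
    then have "collinear G" unfolding collinear_def by blast
    then obtain a b where ab: "G = closed_segment a b"
      using compact_convex_collinear_segment \<open>compact G\<close> \<open>convex G\<close> \<open>x \<in> G\<close>
      by (metis empty_iff)
    have "a \<noteq> b" using ab \<open>x \<in> G\<close> \<open>y \<in> G\<close> y(3) by auto
    have "?M \<inter> edge_points \<sigma> i \<times> edge_points \<sigma> j = closed_segment a b"
      using ab unfolding G_def AB(3) \<open>A = edge_points \<sigma> i\<close> \<open>B = edge_points \<sigma> j\<close> .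
    then have family: "minimum_family \<sigma> l V i j a b"
      unfolding minimum_family_def Let_def collinear_lemma using \<open>a \<noteq> b\<close> parallel by blast
    have in_Strut: "c \<in> Strut \<sigma> l V" if "c \<in> {a, b}" for c
    proof -
      have "c \<in> G" using that ab by auto
      then have "c \<in> VB1 \<sigma> l" "norm (?f c) = 2" using AB(4) x(2) by (auto simp: G_eq)
      then show ?thesis using family that unfolding Strut_separation by blast
    qed
    show ?thesis
    proof (rule that[of a b])
      show "x \<in> closed_segment a b" using \<open>x \<in> G\<close> ab by simp
      have "a \<in> G" "b \<in> G" using ab by auto
      then show "?f a = ?f x" "?f b = ?f x" by (auto simp: G_eq)
    qed (use in_Strut in auto)
  qed
qed

section \<open>Gradients and first-order expansions\<close>

text \<open>
  The gradient is a definite description, so its existence (from the components of the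
  derivative) and its uniqueness are both at stake.
\<close>

lemma gradient_inner:
  fixes f :: "'a::euclidean_space \<Rightarrow> real"
  assumes "(f has_derivative f') (at x)"
  shows "gradient f x \<bullet> w = f' w"
proof -
  have "linear f'" using assms by (rule has_derivative_linear)
  \<comment> \<open>The Riesz representative of \<open>f'\<close>.\<close>
  define D where "D = (\<Sum>b\<in>Basis. f' b *\<^sub>R b)"
  have D: "f' h = h \<bullet> D" for h
  proof -
    have "f' h = f' (\<Sum>b\<in>Basis. (h \<bullet> b) *\<^sub>R b)" by (simp add: euclidean_representation)
    also have "\<dots> = (\<Sum>b\<in>Basis. (h \<bullet> b) * f' b)"
      using \<open>linear f'\<close> by (simp add: linear_sum linear_scale)
    finally show ?thesis by (simp add: D_def inner_sum_right mult.commute)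
  qed
  then have "GDERIV f x :> D" using assms by (simp add: gderiv_def D[abs_def, symmetric])
  moreover have "D' = D" if "GDERIV f x :> D'" for D'
  proof -
    have "(\<lambda>h. h \<bullet> D') = f'"
      using that assms unfolding gderiv_def by (rule has_derivative_unique)
    then have "\<forall>h. h \<bullet> D' = h \<bullet> D" using D by metis
    then show ?thesis using vector_eq_ldot by blast
  qed
  ultimately have "gradient f x = D" unfolding gradient_def by (rule the_equality)
  then show ?thesis using D by (simp add: inner_commute)
qed

lemma directional_derivative:
  fixes f :: "'a::euclidean_space \<Rightarrow> real"
  assumes "f differentiable at x"
  shows "((\<lambda>t. f (x + t *\<^sub>R w)) has_real_derivative gradient f x \<bullet> w) (at 0)"
proof -
  obtain f' where f': "(f has_derivative f') (at x)" using assms by (auto simp: differentiable_def)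
  have line: "((\<lambda>t::real. x + t *\<^sub>R w) has_derivative (\<lambda>t. t *\<^sub>R w)) (at 0)"
    by (auto intro!: derivative_eq_intros)
  have "((\<lambda>t. f (x + t *\<^sub>R w)) has_derivative (\<lambda>t. f' (t *\<^sub>R w))) (at 0)"
    using has_derivative_compose[OF line, of f f'] f' by simp
  moreover have "(\<lambda>t. f' (t *\<^sub>R w)) = (*) (gradient f x \<bullet> w)"
    using has_derivative_linear[OF f'] gradient_inner[OF f', of w]
    by (auto simp: linear_scale mult.commute)
  ultimately show ?thesis by (simp add: has_field_derivative_def)
qed

lemma gradient_half_pdist:
  assumes "separation V (p, q) \<noteq> 0"
  shows "gradient (\<lambda>U. pdist p q U / 2) V \<bullet> W =
    (separation V (p, q) \<bullet> separation W (p, q)) / (2 * norm (separation V (p, q)))"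
proof -
  have sep: "((\<lambda>U. separation U (p, q)) has_derivative (\<lambda>U. separation U (p, q))) (at V)"
    using linear_separation_polygon[of "(p, q)"] linear_conv_bounded_linear
    by (intro bounded_linear_imp_has_derivative) blast
  have "((\<lambda>U. norm (separation U (p, q)) / 2) has_derivative
      (\<lambda>U. (separation U (p, q) \<bullet> sgn (separation V (p, q))) / 2)) (at V)"
    using has_derivative_compose[OF sep has_derivative_norm[OF assms]]
    by (intro bounded_linear.has_derivative[OF bounded_linear_divide])
  then have "gradient (\<lambda>U. pdist p q U / 2) V \<bullet> W =
      (separation W (p, q) \<bullet> sgn (separation V (p, q))) / 2"
    unfolding pdist_separation by (rule gradient_inner)
  moreover have "(w \<bullet> sgn z) / 2 = z \<bullet> w / (2 * norm z)" for z w :: "real^3"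
  proof -
    have "w \<bullet> sgn z = z \<bullet> w / norm z"
      by (simp only: sgn_div_norm inner_scaleR_right inner_commute[of w z] divide_inverse mult.commute)
    then show ?thesis by simp
  qed
  ultimately show ?thesis by (rule trans)
qed

text \<open>
  The remainder is explicit, hence uniform as long as \<open>norm z\<close> stays away from 0 and \<open>norm w\<close> is
  bounded; this serves infinitely many pairs at once. The lower bound is Cauchy-Schwarz for \<open>z\<close>
  and \<open>z + t *\<^sub>R w\<close>; the upper bound is \<open>(N - n)\<^sup>2 \<ge> 0\<close> for the two norms \<open>n\<close> and \<open>N\<close>.
\<close>

lemma norm_expansion:
  fixes z w :: "'a::real_inner"
  assumes "z \<noteq> 0"
  shows "\<bar>norm (z + t *\<^sub>R w) - norm z - t * (z \<bullet> w / norm z)\<bar> \<le> t\<^sup>2 * (norm w)\<^sup>2 / (2 * norm z)"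
proof -
  define n N where "n = norm z" and "N = norm (z + t *\<^sub>R w)"
  have "n > 0" using assms by (simp add: n_def)
  have zz: "z \<bullet> z = n\<^sup>2" by (simp add: n_def power2_norm_eq_inner)
  have sq: "N\<^sup>2 = n\<^sup>2 + 2 * t * (z \<bullet> w) + t\<^sup>2 * (norm w)\<^sup>2"
    unfolding N_def n_def power2_norm_eq_inner
    by (simp add: inner_add_left inner_add_right inner_commute power2_eq_square algebra_simps)
  have "z \<bullet> (z + t *\<^sub>R w) \<le> n * N" unfolding n_def N_def by (rule norm_cauchy_schwarz)
  then have "n\<^sup>2 + t * (z \<bullet> w) \<le> n * N" by (simp add: inner_add_right zz)
  moreover have "n * (N - n - t * (z \<bullet> w / n)) = n * N - n\<^sup>2 - t * (z \<bullet> w)"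
    using \<open>n > 0\<close> by (simp add: algebra_simps power2_eq_square)
  ultimately have "0 \<le> n * (N - n - t * (z \<bullet> w / n))" by simp
  then have lower: "0 \<le> N - n - t * (z \<bullet> w / n)"
    using \<open>n > 0\<close> by (simp add: zero_le_mult_iff)
  have "0 \<le> (N - n)\<^sup>2" by simp
  then have "2 * n * N \<le> 2 * n\<^sup>2 + 2 * t * (z \<bullet> w) + t\<^sup>2 * (norm w)\<^sup>2"
    using sq unfolding power2_diff by (simp add: mult.commute mult.left_commute)
  moreover have "2 * n * (N - n - t * (z \<bullet> w / n)) = 2 * n * N - 2 * n\<^sup>2 - 2 * t * (z \<bullet> w)"
    using \<open>n > 0\<close> by (simp add: algebra_simps power2_eq_square)
  ultimately have "(N - n - t * (z \<bullet> w / n)) * (2 * n) \<le> t\<^sup>2 * (norm w)\<^sup>2"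
    by (simp only: mult.commute[of _ "2 * n"])
  then have "N - n - t * (z \<bullet> w / n) \<le> t\<^sup>2 * (norm w)\<^sup>2 / (2 * n)"
    using \<open>n > 0\<close> by (simp only: pos_le_divide_eq mult_pos_pos zero_less_numeral)
  with lower show ?thesis unfolding N_def n_def by simp
qed

section \<open>Continuity and differentiability of MinRad\<close>

lemma linear_adjacent_edge: "linear (\<lambda>U. adjacent_edge \<sigma> U i s)"
  by (cases s) (auto intro!: linearI simp: edge_def scaleR_diff_right)

lemma adjacent_edge_differentiable: "(\<lambda>U. adjacent_edge \<sigma> U i s) differentiable at V"
  for V :: "real^3^'n::finite"
  by (rule linear_imp_differentiable[OF linear_adjacent_edge])

lemma adjacent_edge_nonzero: "closed_polygon \<sigma> V \<Longrightarrow> adjacent_edge \<sigma> V i s \<noteq> 0"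
  by (cases s) (auto simp: closed_polygon_def)

definition turning_cosine :: "('n \<Rightarrow> 'n) \<Rightarrow> real^3^'n \<Rightarrow> 'n \<Rightarrow> real" where
  "turning_cosine \<sigma> V i =
    adjacent_edge \<sigma> V i Minus \<bullet> adjacent_edge \<sigma> V i Plus /
      (norm (adjacent_edge \<sigma> V i Minus) * norm (adjacent_edge \<sigma> V i Plus))"

lemma turning_angle_cosine: "turning_angle \<sigma> V i = arccos (turning_cosine \<sigma> V i)"
  by (simp add: turning_angle_def turning_cosine_def Let_def)

lemma turning_cosine_bounds: "\<bar>turning_cosine \<sigma> V i\<bar> \<le> 1"
proof -
  have "\<bar>a \<bullet> b / (norm a * norm b)\<bar> \<le> 1" for a b :: "real^3"
    using Cauchy_Schwarz_ineq2[of a b] by (auto simp: divide_le_eq_1 abs_mult)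
  then show ?thesis unfolding turning_cosine_def .
qed

lemma turning_angle_bounds: "0 \<le> turning_angle \<sigma> V i" "turning_angle \<sigma> V i \<le> pi"
  using turning_cosine_bounds[of \<sigma> V i]
  by (auto simp: turning_angle_cosine intro: arccos_lbound arccos_ubound)

lemma minrad_side_nonneg: "0 \<le> minrad_side \<sigma> s i V"
proof -
  have "0 \<le> tan (turning_angle \<sigma> V i / 2)"
  proof (cases "turning_angle \<sigma> V i = pi")
    case False
    then have "turning_angle \<sigma> V i / 2 < pi / 2" using turning_angle_bounds(2)[of \<sigma> V i] by simp
    then show ?thesis
      using turning_angle_bounds(1)[of \<sigma> V i] tan_pos_pi2_le[of "turning_angle \<sigma> V i / 2"] by simp
  qed (simp add: tan_def)
  then show ?thesis by (simp add: minrad_side_def)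
qed

lemma minrad_side_differentiable:
  fixes V :: "real^3^'n::finite"
  assumes polygon: "closed_polygon \<sigma> V" and angle: "turning_angle \<sigma> V i \<noteq> 0" "turning_angle \<sigma> V i \<noteq> pi"
  shows "minrad_side \<sigma> s i differentiable at V"
proof -
  have norm': "(\<lambda>U. norm (adjacent_edge \<sigma> U i s)) differentiable at V" for s
    using differentiable_chain_at[OF adjacent_edge_differentiable
        differentiable_norm_at[OF adjacent_edge_nonzero[OF polygon]]] by (simp add: o_def)
  have cosine: "(\<lambda>U. turning_cosine \<sigma> U i) differentiable at V"
    unfolding turning_cosine_def
    using adjacent_edge_nonzero[OF polygon]
    by (intro differentiable_divide differentiable_mult differentiable_inner norm'
        adjacent_edge_differentiable) (simp del: adjacent_edge.simps)
  have "turning_cosine \<sigma> V i \<noteq> 1" "turning_cosine \<sigma> V i \<noteq> -1"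
    using angle by (auto simp: turning_angle_cosine)
  then have "-1 < turning_cosine \<sigma> V i" "turning_cosine \<sigma> V i < 1"
    using turning_cosine_bounds[of \<sigma> V i] by auto
  from DERIV_arccos[OF this] have "arccos differentiable at (turning_cosine \<sigma> V i)"
    using real_differentiable_def by blast
  from differentiable_chain_at[OF cosine this]
  have angle': "(\<lambda>U. turning_angle \<sigma> U i) differentiable at V"
    by (simp add: o_def turning_angle_cosine)
  have half: "0 < turning_angle \<sigma> V i / 2" "turning_angle \<sigma> V i / 2 < pi / 2"
    using angle turning_angle_bounds[of \<sigma> V i] by auto
  then have "cos (turning_angle \<sigma> V i / 2) > 0" by (intro cos_gt_zero) auto
  from DERIV_tan[OF this[THEN less_imp_neq, symmetric]]
  have "tan differentiable at (turning_angle \<sigma> V i / 2)" using real_differentiable_def by blast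
  moreover have "(\<lambda>U. turning_angle \<sigma> U i / 2) differentiable at V"
    using angle' by (intro differentiable_divide) auto
  ultimately have tan': "(\<lambda>U. tan (turning_angle \<sigma> U i / 2)) differentiable at V"
    using differentiable_chain_at[of "\<lambda>U. turning_angle \<sigma> U i / 2" V tan] by (simp add: o_def)
  have "tan (turning_angle \<sigma> V i / 2) > 0" using half tan_gt_zero by auto
  then have "(\<lambda>U. norm (adjacent_edge \<sigma> U i s) / (2 * tan (turning_angle \<sigma> U i / 2)))
      differentiable at V"
    by (intro differentiable_divide norm' differentiable_mult tan') auto
  then show ?thesis unfolding minrad_side_def[abs_def] .
qed

lemma isCont_adjacent_edge: "isCont (\<lambda>U. adjacent_edge \<sigma> U i s) V"
  for V :: "real^3^'n::finite"
  by (rule differentiable_imp_continuous_within[OF adjacent_edge_differentiable])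

lemma isCont_turning_angle:
  fixes V :: "real^3^'n::finite"
  assumes "closed_polygon \<sigma> V"
  shows "isCont (\<lambda>U. turning_angle \<sigma> U i) V"
proof -
  define S where "S = {U. adjacent_edge \<sigma> U i Minus \<noteq> 0} \<inter> {U. adjacent_edge \<sigma> U i Plus \<noteq> 0}"
  have cont: "continuous_on X (\<lambda>U. adjacent_edge \<sigma> U i s)" for X s
    by (intro continuous_at_imp_continuous_on ballI isCont_adjacent_edge)
  have "open S" unfolding S_def
    by (intro open_Int open_Collect_neq cont continuous_intros)
  moreover have "continuous_on S (\<lambda>U. turning_angle \<sigma> U i)"
    unfolding turning_angle_cosine
  proof (rule continuous_on_arccos)
    show "continuous_on S (\<lambda>U. turning_cosine \<sigma> U i)"
      unfolding turning_cosine_def by (intro continuous_intros cont) (simp_all add: S_def del: adjacent_edge.simps)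
    show "\<forall>U\<in>S. -1 \<le> turning_cosine \<sigma> U i \<and> turning_cosine \<sigma> U i \<le> 1"
      using turning_cosine_bounds[of \<sigma> _ i] by (auto simp: abs_le_iff minus_le_iff)
  qed
  moreover have "V \<in> S" using adjacent_edge_nonzero[OF assms] by (simp add: S_def del: adjacent_edge.simps)
  ultimately show ?thesis using continuous_on_eq_continuous_at by blast
qed

text \<open>
  A vertex with turning angle 0 enters the infimum as soon as a variation bends it, but then with
  a large value: its turning angle is small while its edges keep their length.
\<close>

lemma straight_vertex_large_minrad:
  fixes V :: "real^3^'n::finite"
  assumes polygon: "closed_polygon \<sigma> V" and straight: "turning_angle \<sigma> V i = 0"
  shows "\<forall>\<^sub>F U in nhds V. turning_angle \<sigma> U i \<noteq> 0 \<longrightarrow> 2 \<le> minrad \<sigma> i U"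
proof -
  have angle: "((\<lambda>U. turning_angle \<sigma> U i) \<longlongrightarrow> 0) (nhds V)"
    using isCont_turning_angle[OF polygon, of i] straight
    by (simp add: isCont_def tendsto_nhds_iff)
  have small: "\<forall>\<^sub>F U in nhds V. turning_angle \<sigma> U i < pi"
    using order_tendstoD(2)[OF angle] by simp
  have large: "\<forall>\<^sub>F U in nhds V. 4 * tan (turning_angle \<sigma> U i / 2) < norm (adjacent_edge \<sigma> U i s)" for s
  proof -
    have "((\<lambda>U. turning_angle \<sigma> U i / 2) \<longlongrightarrow> 0 / 2) (nhds V)"
      by (intro tendsto_divide angle) auto
    then have tan': "((\<lambda>U. tan (turning_angle \<sigma> U i / 2)) \<longlongrightarrow> tan (0 / 2)) (nhds V)"
      by (intro isCont_tendsto_compose[of "0 / 2" tan] isCont_tan) simp_all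
    have edge': "((\<lambda>U. adjacent_edge \<sigma> U i s) \<longlongrightarrow> adjacent_edge \<sigma> V i s) (nhds V)"
      using isCont_adjacent_edge[where V = V and \<sigma> = \<sigma> and i = i and s = s]
      by (simp add: isCont_def tendsto_nhds_iff)
    have "((\<lambda>U. norm (adjacent_edge \<sigma> U i s) - 4 * tan (turning_angle \<sigma> U i / 2)) \<longlongrightarrow>
        norm (adjacent_edge \<sigma> V i s) - 4 * tan (0 / 2)) (nhds V)"
      by (intro tendsto_diff tendsto_mult tendsto_norm tendsto_const edge' tan')
    then have "\<forall>\<^sub>F U in nhds V. 0 < norm (adjacent_edge \<sigma> U i s) - 4 * tan (turning_angle \<sigma> U i / 2)"
      using adjacent_edge_nonzero[OF polygon, of i s] by (intro order_tendstoD(1)) auto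
    then show ?thesis by (rule eventually_mono) simp
  qed
  show ?thesis
    using small large[of Minus] large[of Plus]
  proof eventually_elim
    case (elim U)
    have "2 \<le> minrad_side \<sigma> s i U"
      if "turning_angle \<sigma> U i \<noteq> 0" "4 * tan (turning_angle \<sigma> U i / 2) < norm (adjacent_edge \<sigma> U i s)" for s
    proof -
      have "tan (turning_angle \<sigma> U i / 2) > 0"
        using elim(1) that(1) turning_angle_bounds[of \<sigma> U i] by (intro tan_gt_zero) auto
      then show ?thesis using that(2) by (simp add: minrad_side_def field_simps)
    qed
    then show ?case using elim by (simp add: minrad_def)
  qed
qed

lemma bent_vertex_stays_bent:
  fixes V :: "real^3^'n::finite"
  assumes "closed_polygon \<sigma> V" "turning_angle \<sigma> V i \<noteq> 0"
  shows "\<forall>\<^sub>F U in nhds V. turning_angle \<sigma> U i \<noteq> 0"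
  using isCont_turning_angle[OF assms(1), of i] assms(2)
  by (intro tendsto_imp_eventually_ne) (simp add: isCont_def tendsto_nhds_iff)

text \<open>
  The vertex farthest from the origin is bent: if it were straight, it would lie strictly between
  its neighbours, and one of them would be farther away.
\<close>

lemma closed_polygon_has_bent_vertex:
  assumes polygon: "closed_polygon \<sigma> V"
  obtains i where "turning_angle \<sigma> V i \<noteq> 0"
proof -
  have "finite (range (\<lambda>i. norm (V $ i)))" by simp
  then have "Max (range (\<lambda>i. norm (V $ i))) \<in> range (\<lambda>i. norm (V $ i))" by (intro Max_in) auto
  then obtain i where i: "Max (range (\<lambda>i. norm (V $ i))) = norm (V $ i)" by (elim rangeE)
  have far: "norm (V $ j) \<le> norm (V $ i)" for j
    using Max_ge[of "range (\<lambda>i. norm (V $ i))" "norm (V $ j)"] i by simp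
  have "turning_angle \<sigma> V i \<noteq> 0"
  proof
    assume straight: "turning_angle \<sigma> V i = 0"
    define a b where "a = adjacent_edge \<sigma> V i Minus" and "b = adjacent_edge \<sigma> V i Plus"
    have nz: "a \<noteq> 0" "b \<noteq> 0" unfolding a_def b_def by (rule adjacent_edge_nonzero[OF polygon])+
    have "turning_cosine \<sigma> V i = 1"
      using straight cos_arccos[of "turning_cosine \<sigma> V i"] turning_cosine_bounds[of \<sigma> V i]
      by (simp add: turning_angle_cosine abs_le_iff)
    then have ab: "a \<bullet> b = norm a * norm b"
      using nz unfolding turning_cosine_def a_def[symmetric] b_def[symmetric] by simp
    then have par: "norm a *\<^sub>R b = norm b *\<^sub>R a" using norm_cauchy_schwarz_eq by blast
    have "\<sigma> (inv \<sigma> i) = i" using polygon by (simp add: closed_polygon_def bij_is_surj surj_f_inv_f)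
    then have ends: "V $ inv \<sigma> i = V $ i - a" "V $ \<sigma> i = V $ i + b"
      by (simp_all add: a_def b_def edge_def)
    \<comment> \<open>The vertex divides the segment between its neighbours in the ratio of the edge lengths.\<close>
    define u where "u = norm a / (norm a + norm b)"
    have pos: "norm a > 0" "norm b > 0" using nz by auto
    have sum_pos: "norm a + norm b > 0" using pos by (rule add_pos_pos)
    have u: "0 < u" "u < 1"
      unfolding u_def using pos sum_pos by (auto simp only: divide_pos_pos divide_less_eq_1_pos)
    have "1 - u = norm b / (norm a + norm b)" using sum_pos by (simp add: u_def field_simps)
    then have "(1 - u) *\<^sub>R a = (1 / (norm a + norm b)) *\<^sub>R (norm b *\<^sub>R a)" by simp
    moreover have "u *\<^sub>R b = (1 / (norm a + norm b)) *\<^sub>R (norm a *\<^sub>R b)" by (simp add: u_def)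
    ultimately have "u *\<^sub>R b = (1 - u) *\<^sub>R a" by (simp only: par)
    then have "V $ i = (1 - u) *\<^sub>R (V $ inv \<sigma> i) + u *\<^sub>R (V $ \<sigma> i)"
      unfolding ends by (simp add: scaleR_add_right scaleR_diff_right)
    moreover have "V $ inv \<sigma> i \<noteq> V $ \<sigma> i"
    proof
      assume "V $ inv \<sigma> i = V $ \<sigma> i"
      then have "b = - a" unfolding ends by (simp add: algebra_simps eq_neg_iff_add_eq_0)
      then show False using ab nz by (simp add: inner_minus_right dot_square_norm power2_eq_square)
    qed
    ultimately have "V $ i \<in> open_segment (V $ inv \<sigma> i) (V $ \<sigma> i)"
      using u by (auto simp: in_segment)
    from dist_decreases_open_segment[OF this, of 0] show False
      using far[of "inv \<sigma> i"] far[of "\<sigma> i"] by auto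
  qed
  then show ?thesis using that by blast
qed

section \<open>Thickness as an infimum of smooth constraints\<close>

text \<open>
  Curvature and distance constraints form one family, so that the thickness is a single infimum.
  MinRad enters with its two sides separately, since only these are differentiable.
\<close>

definition constraint :: "('n::finite \<Rightarrow> 'n) \<Rightarrow> real^3^'n \<Rightarrow>
    ('n \<times> side) + (real^'n) \<times> (real^'n) \<Rightarrow> real" where
  "constraint \<sigma> U k = (case k of Inl (i, s) \<Rightarrow> minrad_side \<sigma> s i U | Inr x \<Rightarrow> norm (separation U x) / 2)"

lemma constraint_simps [simp]:
  "constraint \<sigma> U (Inl (i, s)) = minrad_side \<sigma> s i U"
  "constraint \<sigma> U (Inr x) = norm (separation U x) / 2"
  by (simp_all add: constraint_def)

text \<open>
  The directional derivative of a constraint at \<open>V\<close>, wherever the constraint is differentiable.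
\<close>

definition slope :: "('n::finite \<Rightarrow> 'n) \<Rightarrow> real^3^'n \<Rightarrow> real^3^'n \<Rightarrow>
    ('n \<times> side) + (real^'n) \<times> (real^'n) \<Rightarrow> real" where
  "slope \<sigma> V W k = (case k of
      Inl (i, s) \<Rightarrow> gradient (minrad_side \<sigma> s i) V \<bullet> W
    | Inr x \<Rightarrow> (separation V x \<bullet> separation W x) / (2 * norm (separation V x)))"

lemma slope_simps [simp]:
  "slope \<sigma> V W (Inl (i, s)) = gradient (minrad_side \<sigma> s i) V \<bullet> W"
  "slope \<sigma> V W (Inr x) = (separation V x \<bullet> separation W x) / (2 * norm (separation V x))"
  by (simp_all add: slope_def)

text \<open>
  The bent vertices are those of the base polygon \<open>V\<close>, also when the constraints are evaluated at
  a nearby polygon; this gives an index set that is constant along a variation.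
\<close>

definition constraint_indices :: "('n::finite \<Rightarrow> 'n) \<Rightarrow> real \<Rightarrow> real^3^'n \<Rightarrow>
    (('n \<times> side) + (real^'n) \<times> (real^'n)) set" where
  "constraint_indices \<sigma> l V = ({i. turning_angle \<sigma> V i \<noteq> 0} \<times> UNIV) <+> VB1 \<sigma> l"

lemma constraint_indices_iff [simp]:
  "Inl (i, s) \<in> constraint_indices \<sigma> l V \<longleftrightarrow> turning_angle \<sigma> V i \<noteq> 0"
  "Inr x \<in> constraint_indices \<sigma> l V \<longleftrightarrow> x \<in> VB1 \<sigma> l"
  by (auto simp: constraint_indices_def InlI InrI)

lemma constraint_nonneg: "0 \<le> constraint \<sigma> U k"
  by (cases k) (auto simp: minrad_side_nonneg)

lemma minrad_constraint:
  obtains s where "minrad \<sigma> i U = constraint \<sigma> U (Inl (i, s))"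
proof (cases "minrad_side \<sigma> Minus i U \<le> minrad_side \<sigma> Plus i U")
  case True
  then show ?thesis using that[of Minus] by (simp add: minrad_def)
next
  case False
  then show ?thesis using that[of Plus] by (simp add: minrad_def)
qed

lemma minrad_le_side: "minrad \<sigma> i U \<le> minrad_side \<sigma> s i U"
  by (cases s) (auto simp: minrad_def)

lemma constraint_indices_nonempty:
  assumes "closed_polygon \<sigma> V"
  shows "constraint_indices \<sigma> l V \<noteq> {}"
proof -
  obtain i where "turning_angle \<sigma> V i \<noteq> 0" using closed_polygon_has_bent_vertex assms by blast
  then have "Inl (i, Plus) \<in> constraint_indices \<sigma> l V" by simp
  then show ?thesis by blast
qed

text \<open>
  The minimum over the two sides of a vertex is absorbed by the infimum, and so is any vertex that is
  bent in \<open>U\<close> only, provided that some constraint in the family is at most its MinRad.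
\<close>

lemma cthi_eq_Inf_constraints:
  assumes nonempty: "constraint_indices \<sigma> l V \<noteq> {}"
    and bent: "\<And>i. turning_angle \<sigma> V i \<noteq> 0 \<Longrightarrow> turning_angle \<sigma> U i \<noteq> 0"
    and straight: "\<And>i. turning_angle \<sigma> V i = 0 \<Longrightarrow> turning_angle \<sigma> U i \<noteq> 0 \<Longrightarrow>
      \<exists>k\<in>constraint_indices \<sigma> l V. constraint \<sigma> U k \<le> minrad \<sigma> i U"
  shows "cthi \<sigma> l U = Inf (constraint \<sigma> U ` constraint_indices \<sigma> l V)"
proof -
  let ?B = "constraint \<sigma> U ` constraint_indices \<sigma> l V"
  let ?A = "{minrad \<sigma> i U | i. turning_angle \<sigma> U i \<noteq> 0} \<union> {pdist p q U / 2 | p q. (p, q) \<in> VB1 \<sigma> l}"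
  have B_bdd: "bdd_below ?B" by (intro bdd_belowI[of _ 0]) (auto simp: constraint_nonneg)
  have A_bdd: "bdd_below ?A"
  proof (rule bdd_belowI[of _ 0])
    fix r assume "r \<in> ?A"
    then obtain x where "r = minrad_side \<sigma> Minus x U \<or> r = minrad_side \<sigma> Plus x U \<or>
        (\<exists>p q. r = pdist p q U / 2)"
      unfolding minrad_def min_def by (auto split: if_splits)
    moreover have "0 \<le> pdist p q U / 2" for p q by (simp add: pdist_def)
    ultimately show "0 \<le> r" using minrad_side_nonneg by metis
  qed
  have A_below: "\<exists>a\<in>?A. a \<le> b" if b: "b \<in> ?B" for b
  proof -
    obtain k where k: "k \<in> constraint_indices \<sigma> l V" "b = constraint \<sigma> U k" using b by blast
    show ?thesis
    proof (cases k)
      case (Inl v)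
      obtain i s where "v = (i, s)" by fastforce
      then have "minrad \<sigma> i U \<in> ?A" "minrad \<sigma> i U \<le> b"
        using k Inl bent minrad_le_side by auto
      then show ?thesis by blast
    next
      case (Inr x)
      obtain p q where x: "x = (p, q)" by fastforce
      then have "b = pdist p q U / 2" "(p, q) \<in> VB1 \<sigma> l"
        using k Inr by (auto simp: pdist_separation)
      then show ?thesis by blast
    qed
  qed
  have B_below: "\<exists>b\<in>?B. b \<le> a" if "a \<in> ?A" for a
    using that
  proof
    assume "a \<in> {minrad \<sigma> i U | i. turning_angle \<sigma> U i \<noteq> 0}"
    then obtain i where i: "turning_angle \<sigma> U i \<noteq> 0" "a = minrad \<sigma> i U" by blast
    show ?thesis
    proof (cases "turning_angle \<sigma> V i = 0")
      case True
      then show ?thesis using straight i by blast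
    next
      case False
      obtain s where "a = constraint \<sigma> U (Inl (i, s))" using minrad_constraint i(2) by metis
      moreover have "Inl (i, s) \<in> constraint_indices \<sigma> l V"
        using False by simp
      ultimately show ?thesis by blast
    qed
  next
    assume "a \<in> {pdist p q U / 2 | p q. (p, q) \<in> VB1 \<sigma> l}"
    then obtain x where "a = constraint \<sigma> U (Inr x)" "Inr x \<in> constraint_indices \<sigma> l V"
      by (auto simp: pdist_separation)
    then show ?thesis by blast
  qed
  have B_nonempty: "?B \<noteq> {}" using nonempty by (simp only: image_is_empty not_False_eq_True)
  then obtain b where "b \<in> ?B" by (meson ex_in_conv)
  from A_below[OF this] have A_nonempty: "?A \<noteq> {}" by (elim bexE) (rule notI, simp only: empty_iff)
  have "Inf ?A \<le> Inf ?B" by (rule cInf_mono[OF B_nonempty A_bdd A_below])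
  moreover have "Inf ?B \<le> Inf ?A" by (rule cInf_mono[OF A_nonempty B_bdd B_below])
  ultimately have "Inf ?A = Inf ?B" by (rule antisym)
  then show ?thesis by (simp only: cthi_def)
qed

lemma cthi_self:
  assumes "closed_polygon \<sigma> V"
  shows "cthi \<sigma> l V = Inf (constraint \<sigma> V ` constraint_indices \<sigma> l V)"
  by (rule cthi_eq_Inf_constraints) (use constraint_indices_nonempty[OF assms] in auto)

lemma cthi_le_constraint:
  assumes "closed_polygon \<sigma> V" "k \<in> constraint_indices \<sigma> l V"
  shows "cthi \<sigma> l V \<le> constraint \<sigma> V k"
  unfolding cthi_self[OF assms(1)] using assms(2) constraint_nonneg
  by (intro cInf_lower bdd_belowI[of _ 0]) auto

text \<open>
  Nearby, the same vertices are bent, apart from straight ones that have become bent with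
  MinRad at least 2. The bound 2, any number above the thickness 1, ensures that these do not
  affect the infimum.
\<close>

lemma cthi_near:
  assumes polygon: "closed_polygon \<sigma> V"
  shows "\<forall>\<^sub>F U in nhds V. Inf (constraint \<sigma> U ` constraint_indices \<sigma> l V) < 2 \<longrightarrow>
    cthi \<sigma> l U = Inf (constraint \<sigma> U ` constraint_indices \<sigma> l V)"
proof -
  have "\<forall>\<^sub>F U in nhds V. (turning_angle \<sigma> V i \<noteq> 0 \<longrightarrow> turning_angle \<sigma> U i \<noteq> 0) \<and>
      (turning_angle \<sigma> V i = 0 \<longrightarrow> turning_angle \<sigma> U i \<noteq> 0 \<longrightarrow> 2 \<le> minrad \<sigma> i U)" for i
    using bent_vertex_stays_bent[OF polygon, of i] straight_vertex_large_minrad[OF polygon, of i]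
    by (cases "turning_angle \<sigma> V i = 0") auto
  then have "\<forall>\<^sub>F U in nhds V. \<forall>i. (turning_angle \<sigma> V i \<noteq> 0 \<longrightarrow> turning_angle \<sigma> U i \<noteq> 0) \<and>
      (turning_angle \<sigma> V i = 0 \<longrightarrow> turning_angle \<sigma> U i \<noteq> 0 \<longrightarrow> 2 \<le> minrad \<sigma> i U)"
    by (rule eventually_all_finite)
  then show ?thesis
  proof eventually_elim
    case (elim U)
    show ?case
    proof
      assume "Inf (constraint \<sigma> U ` constraint_indices \<sigma> l V) < 2"
      from cInf_lessD[OF _ this] obtain k
        where k: "k \<in> constraint_indices \<sigma> l V" "constraint \<sigma> U k < 2"
        using constraint_indices_nonempty[OF polygon] by auto
      show "cthi \<sigma> l U = Inf (constraint \<sigma> U ` constraint_indices \<sigma> l V)"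
      proof (rule cthi_eq_Inf_constraints)
        fix i assume "turning_angle \<sigma> V i = 0" "turning_angle \<sigma> U i \<noteq> 0"
        then have "constraint \<sigma> U k \<le> minrad \<sigma> i U" using elim k(2) by fastforce
        then show "\<exists>k\<in>constraint_indices \<sigma> l V. constraint \<sigma> U k \<le> minrad \<sigma> i U" using k(1) by blast
      qed (use elim constraint_indices_nonempty[OF polygon] in auto)
    qed
  qed
qed

lemma finite_side: "finite (UNIV :: side set)"
proof -
  have "s \<in> {Minus, Plus}" for s by (cases s) auto
  then have "(UNIV :: side set) = {Minus, Plus}" by blast
  then show ?thesis by (metis finite.emptyI finite_insert)
qed

text \<open>
  A turning angle of \<open>pi\<close> makes the half-angle tangent and the quotient 0 by default values, so that
  the thickness could not be positive.
\<close>

lemma no_cusp: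
  assumes "closed_polygon \<sigma> V" "cthi \<sigma> l V > 0" "turning_angle \<sigma> V i \<noteq> 0"
  shows "turning_angle \<sigma> V i \<noteq> pi"
proof
  assume "turning_angle \<sigma> V i = pi"
  then have "constraint \<sigma> V (Inl (i, Plus)) = 0" by (simp add: minrad_side_def tan_def)
  moreover have "Inl (i, Plus) \<in> constraint_indices \<sigma> l V"
    using assms(3) by simp
  ultimately show False using cthi_le_constraint[OF assms(1)] assms(2) by fastforce
qed

lemma continuous_separation: "continuous_on S (separation V)"
  using linear_separation linear_conv_bounded_linear linear_continuous_on by blast

text \<open>
  There are finitely many MinRad constraints, so differentiability of each one is enough. For the
  pairs, the lower bound on the thickness keeps the separations away from 0, and compactness of VB1 bounds their
  velocities.
\<close>

lemma constraint_expansion: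
  fixes \<sigma> :: "'n::finite \<Rightarrow> 'n"
  assumes polygon: "closed_polygon \<sigma> V" and thick: "cthi \<sigma> l V \<ge> 1" and "e > 0"
  shows "\<forall>\<^sub>F t in at_right 0. \<forall>k\<in>constraint_indices \<sigma> l V.
    \<bar>constraint \<sigma> (V + t *\<^sub>R W) k - constraint \<sigma> V k - t * slope \<sigma> V W k\<bar> \<le> e * t"
proof -
  let ?bent = "{i. turning_angle \<sigma> V i \<noteq> 0} \<times> (UNIV :: side set)"
  let ?error = "\<lambda>t k. \<bar>constraint \<sigma> (V + t *\<^sub>R W) k - constraint \<sigma> V k - t * slope \<sigma> V W k\<bar>"
  have one: "\<forall>\<^sub>F t in at_right 0. ?error t (Inl v) \<le> e * t" if bent: "v \<in> ?bent" for v
  proof -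
    obtain i s where v: "v = (i, s)" by fastforce
    then have angle: "turning_angle \<sigma> V i \<noteq> 0" using bent by auto
    then have "minrad_side \<sigma> s i differentiable at V"
      using no_cusp[OF polygon _ angle, of l] thick
      by (intro minrad_side_differentiable[OF polygon]) auto
    from directional_derivative[OF this, of W]
    have "((\<lambda>t. (minrad_side \<sigma> s i (V + t *\<^sub>R W) - minrad_side \<sigma> s i V) / t)
        \<longlongrightarrow> gradient (minrad_side \<sigma> s i) V \<bullet> W) (at_right 0)"
      by (auto simp: has_field_derivative_iff intro: tendsto_mono[OF at_le])
    from tendstoD[OF this \<open>e > 0\<close>] eventually_at_right_less[of 0]
    show ?thesis
    proof eventually_elim
      case (elim t)
      let ?d = "minrad_side \<sigma> s i (V + t *\<^sub>R W) - minrad_side \<sigma> s i V"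
      let ?g = "gradient (minrad_side \<sigma> s i) V \<bullet> W"
      have "?d - t * ?g = (?d / t - ?g) * t" using elim(2) by (simp add: field_simps)
      then have "\<bar>?d - t * ?g\<bar> = \<bar>?d / t - ?g\<bar> * t" using elim(2) by (simp add: abs_mult)
      also have "\<dots> \<le> e * t"
        using elim by (intro mult_right_mono) (auto simp: dist_real_def)
      finally show ?case by (simp add: v)
    qed
  qed
  have "finite ?bent" using finite_side by (intro finite_cartesian_product) auto
  then have minrads: "\<forall>\<^sub>F t in at_right 0. \<forall>v\<in>?bent. ?error t (Inl v) \<le> e * t"
    using one by (intro eventually_ball_finite) auto
  have "bounded (separation W ` VB1 \<sigma> l)"
    by (intro compact_imp_bounded compact_continuous_image continuous_separation compact_VB1)
  then obtain B where B: "B > 0" "\<And>x. x \<in> VB1 \<sigma> l \<Longrightarrow> norm (separation W x) \<le> B"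
    unfolding bounded_pos by blast
  have "((\<lambda>t. t * B\<^sup>2) \<longlongrightarrow> 0 * B\<^sup>2) (at_right 0)" by (intro tendsto_intros)
  then have "\<forall>\<^sub>F t in at_right 0. t * B\<^sup>2 < e" using \<open>e > 0\<close> by (simp add: order_tendstoD)
  then have distances: "\<forall>\<^sub>F t in at_right 0. \<forall>x\<in>VB1 \<sigma> l. ?error t (Inr x) \<le> e * t"
    using eventually_at_right_less[of 0]
  proof eventually_elim
    case (elim t)
    show ?case
    proof
      fix x assume x: "x \<in> VB1 \<sigma> l"
      define z w where "z = separation V x" and "w = separation W x"
      have "1 \<le> norm z"
        using cthi_le_constraint[OF polygon, of "Inr x" l] thick x by (simp add: z_def)
      have "norm w \<le> B" using B x by (simp add: w_def)
      have "?error t (Inr x) = \<bar>norm (z + t *\<^sub>R w) - norm z - t * (z \<bullet> w / norm z)\<bar> / 2"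
        by (simp add: separation_variation z_def[symmetric] w_def[symmetric] field_simps)
      also have "\<dots> \<le> \<bar>norm (z + t *\<^sub>R w) - norm z - t * (z \<bullet> w / norm z)\<bar>" by simp
      also have "\<dots> \<le> t\<^sup>2 * (norm w)\<^sup>2 / (2 * norm z)"
        using \<open>1 \<le> norm z\<close> by (intro norm_expansion) auto
      also have "\<dots> \<le> t\<^sup>2 * (norm w)\<^sup>2 / 1"
        using \<open>1 \<le> norm z\<close> by (intro divide_left_mono) auto
      also have "\<dots> \<le> t\<^sup>2 * B\<^sup>2"
        using \<open>norm w \<le> B\<close> by (simp add: mult_left_mono power_mono)
      also have "\<dots> = t * (t * B\<^sup>2)" by (simp add: power2_eq_square)
      also have "\<dots> \<le> t * e" using elim by (intro mult_left_mono) auto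
      finally show "?error t (Inr x) \<le> e * t" by (simp only: mult.commute)
    qed
  qed
  show ?thesis
    using minrads distances
  proof eventually_elim
    case (elim t)
    show ?case
    proof
      fix k assume "k \<in> constraint_indices \<sigma> l V"
      then show "?error t k \<le> e * t"
        using elim unfolding constraint_indices_def by (elim PlusE) blast+
    qed
  qed
qed

text \<open>
  Finitely many points together with a continuous image of the compact set VB1.
\<close>

lemma compact_constraint_graph:
  assumes polygon: "closed_polygon \<sigma> V" and thick: "cthi \<sigma> l V > 0"
  shows "compact ((\<lambda>k. (constraint \<sigma> V k, slope \<sigma> V W k)) ` constraint_indices \<sigma> l V)"
proof -
  let ?bent = "{i. turning_angle \<sigma> V i \<noteq> 0} \<times> (UNIV :: side set)"
  let ?g = "\<lambda>k. (constraint \<sigma> V k, slope \<sigma> V W k)"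
  have "finite ?bent" using finite_side by (intro finite_cartesian_product) auto
  then have "compact (?g ` Inl ` ?bent)" by (intro finite_imp_compact finite_imageI)
  moreover have "compact ((\<lambda>x. ?g (Inr x)) ` VB1 \<sigma> l)"
  proof (rule compact_continuous_image[OF _ compact_VB1])
    have nonzero: "separation V x \<noteq> 0" if "x \<in> VB1 \<sigma> l" for x
      using cthi_le_constraint[OF polygon, of "Inr x" l] thick that by auto
    show "continuous_on (VB1 \<sigma> l) (\<lambda>x. ?g (Inr x))"
      unfolding constraint_simps slope_simps
      by (intro continuous_intros continuous_separation) (use nonzero in auto)
  qed
  moreover have "?g ` constraint_indices \<sigma> l V = ?g ` Inl ` ?bent \<union> (\<lambda>x. ?g (Inr x)) ` VB1 \<sigma> l"
    unfolding constraint_indices_def Plus_def by (simp only: image_Un image_image)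
  ultimately show ?thesis by (simp only: compact_Un)
qed

section \<open>Infinitesimal motions\<close>

lemma right_derivative_cthi:
  fixes \<sigma> :: "'n::finite \<Rightarrow> 'n"
  assumes polygon: "closed_polygon \<sigma> V" and thick: "cthi \<sigma> l V = 1"
  obtains k0 where "k0 \<in> constraint_indices \<sigma> l V" "constraint \<sigma> V k0 = 1"
    "\<And>k. k \<in> constraint_indices \<sigma> l V \<Longrightarrow> constraint \<sigma> V k = 1 \<Longrightarrow> slope \<sigma> V W k0 \<le> slope \<sigma> V W k"
    "((\<lambda>t. cthi \<sigma> l (V + t *\<^sub>R W)) has_real_derivative slope \<sigma> V W k0) (at_right 0)"
proof -
  let ?K = "constraint_indices \<sigma> l V" and ?f = "\<lambda>t k. constraint \<sigma> (V + t *\<^sub>R W) k"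
  have "compact ((\<lambda>k. (?f 0 k, slope \<sigma> V W k)) ` ?K)"
    using compact_constraint_graph[OF polygon] thick by simp
  moreover have "?K \<noteq> {}" by (rule constraint_indices_nonempty[OF polygon])
  moreover have "\<forall>\<^sub>F t in at_right 0. \<forall>k\<in>?K. \<bar>?f t k - ?f 0 k - t * slope \<sigma> V W k\<bar> \<le> e * t"
    if "e > 0" for e
    using constraint_expansion[OF polygon _ that] thick by simp
  ultimately obtain k0 where k0: "k0 \<in> ?K" "\<forall>k\<in>?K. ?f 0 k0 \<le> ?f 0 k"
    "\<forall>k\<in>?K. ?f 0 k = ?f 0 k0 \<longrightarrow> slope \<sigma> V W k0 \<le> slope \<sigma> V W k"
    "((\<lambda>t. Inf (?f t ` ?K)) has_real_derivative slope \<sigma> V W k0) (at_right 0)"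
    by (rule right_derivative_of_infimum[of ?f "slope \<sigma> V W" ?K])
  have at0: "Inf (?f 0 ` ?K) = 1" using thick cthi_self[OF polygon, of l] by simp
  have "Inf (?f 0 ` ?K) = ?f 0 k0" using k0(1,2) by (intro cInf_eq_minimum) auto
  then have active: "constraint \<sigma> V k0 = 1" using at0 by simp
  have "((\<lambda>t. Inf (?f t ` ?K)) \<longlongrightarrow> 1) (at_right 0)"
    using DERIV_continuous[OF k0(4)] at0 by (simp add: continuous_within)
  then have small: "\<forall>\<^sub>F t in at_right 0. Inf (?f t ` ?K) < 2" by (rule order_tendstoD) simp
  have "((\<lambda>t::real. V + t *\<^sub>R W) \<longlongrightarrow> V + 0 *\<^sub>R W) (at_right 0)" by (intro tendsto_intros)
  then have "filterlim (\<lambda>t::real. V + t *\<^sub>R W) (nhds V) (at_right 0)" by simp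
  from eventually_compose_filterlim[OF cthi_near[OF polygon, of l] this] small
  have "\<forall>\<^sub>F t in at_right 0. Inf (?f t ` ?K) = cthi \<sigma> l (V + t *\<^sub>R W)"
    by eventually_elim simp
  from has_field_derivative_cong_eventually[OF this, of "slope \<sigma> V W k0"]
  have "((\<lambda>t. cthi \<sigma> l (V + t *\<^sub>R W)) has_real_derivative slope \<sigma> V W k0) (at_right 0)"
    using k0(4) at0 thick by simp
  then show ?thesis using that[of k0] k0 active by simp
qed

text \<open>
  The defining condition asks for some nonnegative one-sided derivative; the derivative exists, is
  unique, and is the smallest active slope.
\<close>

lemma infinitesimal_motion_iff_slopes:
  fixes \<sigma> :: "'n::finite \<Rightarrow> 'n"
  assumes polygon: "closed_polygon \<sigma> V" and thick: "cthi \<sigma> l V = 1"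
  shows "W \<in> infinitesimal_motions \<sigma> l V \<longleftrightarrow>
    (\<forall>k\<in>constraint_indices \<sigma> l V. constraint \<sigma> V k = 1 \<longrightarrow> 0 \<le> slope \<sigma> V W k)"
proof -
  obtain k0 where k0: "k0 \<in> constraint_indices \<sigma> l V" "constraint \<sigma> V k0 = 1"
    "\<And>k. k \<in> constraint_indices \<sigma> l V \<Longrightarrow> constraint \<sigma> V k = 1 \<Longrightarrow> slope \<sigma> V W k0 \<le> slope \<sigma> V W k"
    "((\<lambda>t. cthi \<sigma> l (V + t *\<^sub>R W)) has_real_derivative slope \<sigma> V W k0) (at_right 0)"
    using right_derivative_cthi[OF polygon thick] by blast
  have "D = slope \<sigma> V W k0"
    if "((\<lambda>t. cthi \<sigma> l (V + t *\<^sub>R W)) has_real_derivative D) (at_right 0)" for D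
    using that k0(4) unfolding has_field_derivative_iff
    by (rule tendsto_unique[OF trivial_limit_at_right_real])
  then have "W \<in> infinitesimal_motions \<sigma> l V \<longleftrightarrow> 0 \<le> slope \<sigma> V W k0"
    using k0(4) unfolding infinitesimal_motions_def thick mem_Collect_eq by blast
  also have "\<dots> \<longleftrightarrow>
      (\<forall>k\<in>constraint_indices \<sigma> l V. constraint \<sigma> V k = 1 \<longrightarrow> 0 \<le> slope \<sigma> V W k)"
  proof
    assume "0 \<le> slope \<sigma> V W k0"
    then show "\<forall>k\<in>constraint_indices \<sigma> l V. constraint \<sigma> V k = 1 \<longrightarrow> 0 \<le> slope \<sigma> V W k"
      using k0(3) by (meson order_trans)
  qed (use k0(1,2) in blast)
  finally show ?thesis .
qed

text \<open>
  The slope at an active pair is a convex combination of the slopes at two struts with the same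
  separation vector.
\<close>

lemma slopes_nonneg_iff_struts_and_kinks:
  fixes \<sigma> :: "'n::finite \<Rightarrow> 'n"
  assumes polygon: "closed_polygon \<sigma> V" and thick: "cthi \<sigma> l V = 1"
  shows "(\<forall>k\<in>constraint_indices \<sigma> l V. constraint \<sigma> V k = 1 \<longrightarrow> 0 \<le> slope \<sigma> V W k) \<longleftrightarrow>
    (\<forall>x\<in>Strut \<sigma> l V. 0 \<le> slope \<sigma> V W (Inr x)) \<and> (\<forall>x\<in>Kink \<sigma> V. 0 \<le> slope \<sigma> V W (Inl x))"
    (is "?all \<longleftrightarrow> ?struts \<and> ?kinks")
proof
  assume nonneg: ?all
  have ?struts
  proof
    fix x assume "x \<in> Strut \<sigma> l V"
    then have "Inr x \<in> constraint_indices \<sigma> l V" "constraint \<sigma> V (Inr x) = 1"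
      by (simp_all add: Strut_separation)
    then show "0 \<le> slope \<sigma> V W (Inr x)" using nonneg by blast
  qed
  moreover have ?kinks
  proof
    fix x assume "x \<in> Kink \<sigma> V"
    then have "Inl x \<in> constraint_indices \<sigma> l V" "constraint \<sigma> V (Inl x) = 1"
      by (auto simp: Kink_def)
    then show "0 \<le> slope \<sigma> V W (Inl x)" using nonneg by blast
  qed
  ultimately show "?struts \<and> ?kinks" ..
next
  assume nonneg: "?struts \<and> ?kinks"
  show ?all
  proof (intro ballI impI)
    fix k assume k: "k \<in> constraint_indices \<sigma> l V" "constraint \<sigma> V k = 1"
    show "0 \<le> slope \<sigma> V W k"
    proof (cases k)
      case (Inl x)
      then have "x \<in> Kink \<sigma> V" using k by (cases x) (auto simp: Kink_def)
      then show ?thesis using nonneg Inl by blast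
    next
      case (Inr x)
      have x: "x \<in> VB1 \<sigma> l" "norm (separation V x) = 2"
        using k Inr by auto
      have "2 \<le> norm (separation V y)" if "y \<in> VB1 \<sigma> l" for y
        using cthi_le_constraint[OF polygon, of "Inr y" l] thick that by simp
      from shortest_pair_between_struts[OF polygon x this]
      obtain a b where ab: "a \<in> Strut \<sigma> l V" "b \<in> Strut \<sigma> l V" "x \<in> closed_segment a b"
        "separation V a = separation V x" "separation V b = separation V x"
        by blast
      obtain u where u: "0 \<le> u" "u \<le> 1" "x = (1 - u) *\<^sub>R a + u *\<^sub>R b"
        using ab(3) by (auto simp: in_segment)
      define h where "h = (\<lambda>y. separation V x \<bullet> separation W y)"
      have slope_h: "slope \<sigma> V W (Inr y) = h y / 4" if "separation V y = separation V x" for y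
        using that x(2) by (simp add: h_def)
      have "0 \<le> h a" "0 \<le> h b"
        using nonneg ab(1,2) slope_h[OF ab(4)] slope_h[OF ab(5)] by fastforce+
      moreover have "h x = (1 - u) * h a + u * h b"
        using u(3) linear_separation[of W]
        by (simp add: h_def linear_add linear_scale inner_add_right)
      ultimately have "0 \<le> h x" using u by simp
      then show ?thesis using slope_h[of x] Inr by simp
    qed
  qed
qed

theorem corollary2p13:
  fixes l :: real and \<sigma> :: "'n::finite \<Rightarrow> 'n" and V :: "real^3^'n"
  assumes "l > 0"
    and "closed_polygon \<sigma> V"
    and "cthi \<sigma> l V \<ge> 1"
  shows "infinitesimal_motions \<sigma> l V =
    dual_cone ({- gradient (\<lambda>U. pdist p q U / 2) V | p q. (p, q) \<in> Strut \<sigma> l V} \<union>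
               {- gradient (minrad_side \<sigma> s i) V | i s. (i, s) \<in> Kink \<sigma> V})"
    (is "_ = dual_cone (?S \<union> ?K)")
proof (cases "cthi \<sigma> l V = 1")
  case True
  have strut: "gradient (\<lambda>U. pdist p q U / 2) V \<bullet> W = slope \<sigma> V W (Inr (p, q))"
    if "(p, q) \<in> Strut \<sigma> l V" for p q W
  proof -
    have "norm (separation V (p, q)) = 2" using that by (simp add: Strut_separation)
    then show ?thesis using gradient_half_pdist[of V p q W] by fastforce
  qed
  have S: "?S = (\<lambda>(p, q). - gradient (\<lambda>U. pdist p q U / 2) V) ` Strut \<sigma> l V" by auto
  have K: "?K = (\<lambda>(i, s). - gradient (minrad_side \<sigma> s i) V) ` Kink \<sigma> V" by auto
  show ?thesis
  proof (rule set_eqI)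
    fix W
    have "(\<forall>X\<in>?S. W \<bullet> X \<le> 0) \<longleftrightarrow> (\<forall>x\<in>Strut \<sigma> l V. 0 \<le> slope \<sigma> V W (Inr x))"
      unfolding S ball_simps
    proof (intro ball_cong refl)
      fix x assume "x \<in> Strut \<sigma> l V"
      then show "W \<bullet> (case x of (p, q) \<Rightarrow> - gradient (\<lambda>U. pdist p q U / 2) V) \<le> 0 \<longleftrightarrow>
          0 \<le> slope \<sigma> V W (Inr x)"
        by (cases x) (simp add: strut inner_commute[of W] del: slope_simps)
    qed
    moreover have "(\<forall>X\<in>?K. W \<bullet> X \<le> 0) \<longleftrightarrow> (\<forall>x\<in>Kink \<sigma> V. 0 \<le> slope \<sigma> V W (Inl x))"
      unfolding K by (auto simp: inner_commute[of W])
    moreover have "W \<in> dual_cone (?S \<union> ?K) \<longleftrightarrow>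
        (\<forall>X\<in>?S. W \<bullet> X \<le> 0) \<and> (\<forall>X\<in>?K. W \<bullet> X \<le> 0)"
      unfolding dual_cone_def by blast
    ultimately show "W \<in> infinitesimal_motions \<sigma> l V \<longleftrightarrow> W \<in> dual_cone (?S \<union> ?K)"
      unfolding infinitesimal_motion_iff_slopes[OF assms(2) True]
        slopes_nonneg_iff_struts_and_kinks[OF assms(2) True] by (simp only:)
  qed
next
  case False
  then have "cthi \<sigma> l V > 1" using assms(3) by simp
  then have inactive: "constraint \<sigma> V k \<noteq> 1" if "k \<in> constraint_indices \<sigma> l V" for k
    using cthi_le_constraint[OF assms(2) that] by auto
  have "Strut \<sigma> l V = {}"
  proof (rule equals0I)
    fix x assume "x \<in> Strut \<sigma> l V"
    then show False using inactive[of "Inr x"] by (simp add: Strut_separation)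
  qed
  moreover have "Kink \<sigma> V = {}"
  proof (rule equals0I)
    fix x assume "x \<in> Kink \<sigma> V"
    then show False using inactive[of "Inl x"] by (auto simp: Kink_def)
  qed
  ultimately show ?thesis
    using \<open>cthi \<sigma> l V > 1\<close> by (auto simp: dual_cone_def infinitesimal_motions_def)
qed

end
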